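(* Let $S$ be a Polish space with Borel $\sigma$-algebra $\mathcal B$ and let $\preceq$ be a closed partial order on $S$. Let $\mathcal P$ be the set of Borel probability measures on $S$, and define $\tau \colon \mathcal P \times \mathcal P \to [0,1]$ by $$\tau(\mu,\nu) := \max_{(X,Y) \in \Pi(\mu,\nu)} \mathbb P\{X \preceq Y\},$$ where $\Pi(\mu,\nu)$ is the set of all couplings of $\mu$ and $\nu$. Then $\tau$ is the only measure of degree of stochastic dominance satisfying both Axiom C and Axiom M (as defined in the context). That is, $\tau$ is a measure of degree of stochastic dominance satisfying Axiom C and Axiom M, and if $\delta \colon \mathcal P \times \mathcal P \to [0,1]$ is any measure of degree of stochastic dominance satisfying Axiom C and Axiom M, then $\delta(\mu,\nu) = \tau(\mu,\nu)$ for all $(\mu,\nu) \in \mathcal P \times \mathcal P$.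
   Context: A closed partial order $\preceq$ on $S$ is a partial order such that $\{(x,y) \in S\times S : x \preceq y\}$ is closed in the product topology. A function $h \colon S \to \mathbb R$ is increasing if $x \preceq y$ implies $h(x) \le h(y)$. Let $\mathcal H$ be the set of increasing Borel measurable functions $h \colon S \to \mathbb R$ with $\sup h - \inf h \le 1$. Let $\mathcal M$ be the set of all finite (nonnegative) measures on $(S,\mathcal B)$ and let $\mathcal P$ be the set of $\mu \in \mathcal M$ with $\mu(S)=1$. Stochastic dominance: for $\mu,\nu \in \mathcal M$, write $\mu \preceq_{sd} \nu$ if $\mu(S)=\nu(S)$ and $\int h\,d\mu \le \int h\,d\nu$ for all $h \in \mathcal H$. Couplings: for $(\mu,\nu) \in \mathcal P\times\mathcal P$, a coupling of $(\mu,\nu)$ is a pair of $S$-valued random variables $(X,Y)$ defined on some (common) probability space $(\Omega,\mathcal F,\mathbb P)$ with $\mathbb P\{X\in B\}=\mu(B)$ and $\mathbb P\{Y\in B\}=\nu(B)$ for all $B\in\mathcal B$; $\Pi(\mu,\nu)$ denotes the set of all couplings. The maximum in the definition of $\tau$ is attained for every $(\mu,\nu)$. A measure of degree of stochastic dominance is a function $\delta \colon \mathcal P\times\mathcal P \to [0,1]$ such that $\mu \preceq_{sd} \nu$ implies $\delta(\mu,\nu)=1$. For $\mu,\nu\in\mathcal M$, write $\mu \le \nu$ if $\mu(B)\le\nu(B)$ for all $B\in\mathcal B$. For $\mu,\nu\in\mathcal P$, let $$\Phi(\mu,\nu) := \{(\mu',\nu')\in\mathcal M\times\mathcal M : \mu'\le\mu,\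 \nu'\le\nu,\ \mu'\preceq_{sd}\nu'\}.$$ Axiom C (for $\delta$): for each $(\mu,\nu)\in\mathcal P\times\mathcal P$ and each $\epsilon>0$ there exists $(\mu',\nu')\in\Phi(\mu,\nu)$ such that $\delta(\mu,\nu)\le\mu'(S)+\epsilon$. Axiom M (for $\delta$): for all $\mu_a,\mu_b,\nu_a,\nu_b\in\mathcal P$ and $\lambda\in[0,1]$, if $\mu_a\preceq_{sd}\nu_a$ then $\delta(\mu,\nu)\ge\lambda$, where $\mu:=\lambda\mu_a+(1-\lambda)\mu_b$ and $\nu:=\lambda\nu_a+(1-\lambda)\nu_b$. *)

theory Defs
  imports "HOL-Probability.Probability"
begin

definition closed_partial_order :: "('a::polish_space \<Rightarrow> 'a \<Rightarrow> bool) \<Rightarrow> bool" where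
  "closed_partial_order r \<longleftrightarrow> reflp r \<and> antisymp r \<and> transp r \<and> closed {(x, y). r x y}"

text \<open>The set \<open>\<H>\<close>. Boundedness is implicit in \<open>sup h - inf h \<le> 1\<close>, where the extrema are
  extended reals; for the real-valued \<open>SUP\<close> and \<open>INF\<close> it has to be required explicitly.\<close>

definition increasing_fns :: "('a::polish_space \<Rightarrow> 'a \<Rightarrow> bool) \<Rightarrow> ('a \<Rightarrow> real) set" where
  "increasing_fns r = {h. monotone r (\<le>) h \<and> h \<in> borel_measurable borel \<and>
     bounded (range h) \<and> (SUP x. h x) - (INF x. h x) \<le> 1}"

definition finite_measures :: "'a::polish_space measure set" where
  "finite_measures = {\<mu>. sets \<mu> = sets borel \<and> finite_measure \<mu>}"

definition prob_measures :: "'a::polish_space measure set" where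
  "prob_measures = {\<mu> \<in> finite_measures. measure \<mu> UNIV = 1}"

definition sd_le ::
  "('a::polish_space \<Rightarrow> 'a \<Rightarrow> bool) \<Rightarrow> 'a measure \<Rightarrow> 'a measure \<Rightarrow> bool" where
  "sd_le r \<mu> \<nu> \<longleftrightarrow> measure \<mu> UNIV = measure \<nu> UNIV \<and>
     (\<forall>h\<in>increasing_fns r. (LINT x|\<mu>. h x) \<le> (LINT x|\<nu>. h x))"

definition setwise_le :: "'a::polish_space measure \<Rightarrow> 'a measure \<Rightarrow> bool" where
  "setwise_le \<mu> \<nu> \<longleftrightarrow> (\<forall>B\<in>sets borel. emeasure \<mu> B \<le> emeasure \<nu> B)"

definition ordered_component_pairs ::
  "('a::polish_space \<Rightarrow> 'a \<Rightarrow> bool) \<Rightarrow> 'a measure \<Rightarrow> 'a measure \<Rightarrow> ('a measure \<times> 'a measure) set" where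
  "ordered_component_pairs r \<mu> \<nu> = {(\<mu>', \<nu>') \<in> finite_measures \<times> finite_measures.
     setwise_le \<mu>' \<mu> \<and> setwise_le \<nu>' \<nu> \<and> sd_le r \<mu>' \<nu>'}"

text \<open>A coupling consists of a probability space together with two random variables on it.\<close>

definition couplings ::
  "'a::polish_space measure \<Rightarrow> 'a measure \<Rightarrow> ('w measure \<times> ('w \<Rightarrow> 'a) \<times> ('w \<Rightarrow> 'a)) set" where
  "couplings \<mu> \<nu> = {(P, X, Y). prob_space P \<and> X \<in> P \<rightarrow>\<^sub>M borel \<and> Y \<in> P \<rightarrow>\<^sub>M borel \<and>
     (\<forall>B\<in>sets borel. measure P {w \<in> space P. X w \<in> B} = measure \<mu> B \<and>
                     measure P {w \<in> space P. Y w \<in> B} = measure \<nu> B)}"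

definition order_prob ::
  "('a::polish_space \<Rightarrow> 'a \<Rightarrow> bool) \<Rightarrow> 'w measure \<times> ('w \<Rightarrow> 'a) \<times> ('w \<Rightarrow> 'a) \<Rightarrow> real" where
  "order_prob r = (\<lambda>(P, X, Y). measure P {w \<in> space P. r (X w) (Y w)})"

text \<open>HOL cannot quantify over the type of the sample space inside a definition, so the maximum is
  taken over couplings whose sample space is of type \<open>'a \<times> 'a\<close>. By \<open>order_prob_canonical\<close> below,
  couplings on sample spaces of any other type contribute no further values.
  On a set of reals \<open>GREATEST\<close> denotes the maximum, and is meaningful only if that is attained.\<close>

definition tau :: "('a::polish_space \<Rightarrow> 'a \<Rightarrow> bool) \<Rightarrow> 'a measure \<Rightarrow> 'a measure \<Rightarrow> real" where
  "tau r \<mu> \<nu> = (GREATEST p. p \<in> order_prob r `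
     (couplings \<mu> \<nu> :: (('a \<times> 'a) measure \<times> ('a \<times> 'a \<Rightarrow> 'a) \<times> ('a \<times> 'a \<Rightarrow> 'a)) set))"

lemma order_prob_canonical:
  fixes c :: "'w measure \<times> ('w \<Rightarrow> 'a::polish_space) \<times> ('w \<Rightarrow> 'a)"
  assumes "closed_partial_order r" and c: "c \<in> couplings \<mu> \<nu>"
  shows "order_prob r c \<in> order_prob r `
     (couplings \<mu> \<nu> :: (('a \<times> 'a) measure \<times> ('a \<times> 'a \<Rightarrow> 'a) \<times> ('a \<times> 'a \<Rightarrow> 'a)) set)"
proof -
  obtain P X Y where c_eq: "c = (P, X, Y)" by (cases c)
  interpret prob_space P using c by (simp add: c_eq couplings_def)
  have [measurable]: "X \<in> P \<rightarrow>\<^sub>M borel" "Y \<in> P \<rightarrow>\<^sub>M borel"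
    using c by (simp_all add: c_eq couplings_def)
  define Q where "Q = distr P (borel \<Otimes>\<^sub>M borel) (\<lambda>w. (X w, Y w))"
  have XY[measurable]: "(\<lambda>w. (X w, Y w)) \<in> P \<rightarrow>\<^sub>M borel \<Otimes>\<^sub>M borel" by measurable
  have Q: "prob_space Q" unfolding Q_def by (rule prob_space_distr) measurable
  have pull: "measure Q {z \<in> space Q. R z} = measure P {w \<in> space P. R (X w, Y w)}"
    if "{z. R z} \<in> sets (borel \<Otimes>\<^sub>M borel)" for R
    unfolding Q_def using that
    by (subst measure_distr[OF XY]) (auto simp: space_pair_measure intro!: arg_cong[where f = "measure P"])
  have fst_sets: "{z :: 'a \<times> 'a. fst z \<in> B} \<in> sets (borel \<Otimes>\<^sub>M borel)"
    and snd_sets: "{z :: 'a \<times> 'a. snd z \<in> B} \<in> sets (borel \<Otimes>\<^sub>M borel)"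
    if [measurable]: "B \<in> sets borel" for B :: "'a set"
  proof -
    have "{z \<in> space (borel \<Otimes>\<^sub>M borel). fst z \<in> B} \<in> sets (borel \<Otimes>\<^sub>M (borel :: 'a measure))"
      "{z \<in> space (borel \<Otimes>\<^sub>M borel). snd z \<in> B} \<in> sets ((borel :: 'a measure) \<Otimes>\<^sub>M borel)"
      by measurable
    then show "{z :: 'a \<times> 'a. fst z \<in> B} \<in> sets (borel \<Otimes>\<^sub>M borel)" "{z :: 'a \<times> 'a. snd z \<in> B} \<in> sets (borel \<Otimes>\<^sub>M borel)"
      by (simp_all add: space_pair_measure)
  qed
  have "closed {z :: 'a \<times> 'a. r (fst z) (snd z)}"
    using assms(1) by (simp add: closed_partial_order_def case_prod_unfold)
  then have r_sets: "{z :: 'a \<times> 'a. r (fst z) (snd z)} \<in> sets (borel \<Otimes>\<^sub>M borel)"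
    unfolding borel_prod by (rule borel_closed)
  have meas: "fst \<in> Q \<rightarrow>\<^sub>M borel" "snd \<in> Q \<rightarrow>\<^sub>M borel" unfolding Q_def by measurable
  have "(Q, fst, snd) \<in> couplings \<mu> \<nu>"
    using c Q meas by (simp add: c_eq couplings_def pull[OF fst_sets] pull[OF snd_sets])
  moreover have "order_prob r c = order_prob r (Q, fst, snd)"
    by (simp add: c_eq order_prob_def pull[OF r_sets])
  ultimately show ?thesis by blast
qed

text \<open>A measure of degree of stochastic dominance; only its values on probability measures matter.\<close>

definition sd_degree ::
  "('a::polish_space \<Rightarrow> 'a \<Rightarrow> bool) \<Rightarrow> ('a measure \<Rightarrow> 'a measure \<Rightarrow> real) \<Rightarrow> bool" where
  "sd_degree r \<delta> \<longleftrightarrow> (\<forall>\<mu>\<in>prob_measures. \<forall>\<nu>\<in>prob_measures.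
     0 \<le> \<delta> \<mu> \<nu> \<and> \<delta> \<mu> \<nu> \<le> 1 \<and> (sd_le r \<mu> \<nu> \<longrightarrow> \<delta> \<mu> \<nu> = 1))"

definition axiom_C ::
  "('a::polish_space \<Rightarrow> 'a \<Rightarrow> bool) \<Rightarrow> ('a measure \<Rightarrow> 'a measure \<Rightarrow> real) \<Rightarrow> bool" where
  "axiom_C r \<delta> \<longleftrightarrow> (\<forall>\<mu>\<in>prob_measures. \<forall>\<nu>\<in>prob_measures. \<forall>\<epsilon>>0.
     \<exists>(\<mu>', \<nu>')\<in>ordered_component_pairs r \<mu> \<nu>. \<delta> \<mu> \<nu> \<le> measure \<mu>' UNIV + \<epsilon>)"

text \<open>The convex combination \<open>l \<mu> + (1 - l) \<nu>\<close>, for \<open>0 \<le> l \<le> 1\<close>.\<close>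

definition mixture :: "real \<Rightarrow> 'a::polish_space measure \<Rightarrow> 'a measure \<Rightarrow> 'a measure" where
  "mixture l \<mu> \<nu> = measure_of UNIV (sets borel)
     (\<lambda>B. ennreal l * emeasure \<mu> B + ennreal (1 - l) * emeasure \<nu> B)"

lemma sets_mixture: "sets (mixture l \<mu> \<nu>) = sets borel"
  unfolding mixture_def using sets.sigma_sets_eq[of "borel :: 'a measure"] by simp

lemma emeasure_mixture:
  assumes "sets \<mu> = sets borel" "sets \<nu> = sets borel" "B \<in> sets borel"
  shows "emeasure (mixture l \<mu> \<nu>) B = ennreal l * emeasure \<mu> B + ennreal (1 - l) * emeasure \<nu> B"
unfolding mixture_def
proof (rule emeasure_measure_of_sigma)
  show "sigma_algebra UNIV (sets (borel :: 'a measure))"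
    using sets.sigma_algebra_axioms[of "borel :: 'a measure"] by simp
  show "positive (sets borel) (\<lambda>B. ennreal l * emeasure \<mu> B + ennreal (1 - l) * emeasure \<nu> B)"
    by (simp add: positive_def)
  show "countably_additive (sets borel)
      (\<lambda>B. ennreal l * emeasure \<mu> B + ennreal (1 - l) * emeasure \<nu> B)"
    unfolding countably_additive_def using assms(1,2)
    by (auto simp: suminf_add[symmetric] ennreal_suminf_cmult suminf_emeasure)
qed (use assms in simp)

definition axiom_M ::
  "('a::polish_space \<Rightarrow> 'a \<Rightarrow> bool) \<Rightarrow> ('a measure \<Rightarrow> 'a measure \<Rightarrow> real) \<Rightarrow> bool" where
  "axiom_M r \<delta> \<longleftrightarrow> (\<forall>\<mu>a\<in>prob_measures. \<forall>\<mu>b\<in>prob_measures.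
     \<forall>\<nu>a\<in>prob_measures. \<forall>\<nu>b\<in>prob_measures. \<forall>l\<in>{0..1}.
     sd_le r \<mu>a \<nu>a \<longrightarrow> l \<le> \<delta> (mixture l \<mu>a \<mu>b) (mixture l \<nu>a \<nu>b))"

end

theory Submission imports Defs begin

text \<open>Axiom C for one measure of degree and Axiom M for another force an inequality between the two:
  an ordered component pair of mass \<open>m\<close> is, after normalisation, the first term of a mixture with
  weight \<open>m\<close>. So everything rests on \<open>\<tau>\<close> satisfying both axioms. Axiom C follows by restricting an
  optimal coupling to the order, Axiom M by mixing a coupling supported on the order with an
  independent one; this requires the maximum to be attained and Strassen's theorem.

  Both come from the same compactness argument. Membership of \<open>x\<close> and \<open>y\<close> in the sets of a countable base
  turns \<open>(x, y)\<close> into a bit sequence from which it can be recovered measurably. Along a subsequence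
  the laws of all finite initial segments converge, the limits are the laws of a random bit sequence,
  and since the marginals are fixed, its even and odd bits almost surely decode to points with the
  required laws. For Strassen's theorem the approximating couplings come from a transport
  problem on the finite partition generated by the first \<open>n\<close> base sets, which Hall's condition solves.\<close>

subsection \<open>Transport on finite sets\<close>

text \<open>Rows are met exactly while columns are only bounded: this is the form that Hall's
  condition characterises and that survives deleting vertices. When the totals of \<open>a\<close>
  and \<open>b\<close> agree, the columns become exact as well. Since \<open>p\<close> vanishes off
  \<open>I\<close> and \<open>J\<close>, plans on smaller index sets can be added without changing
  their sums.\<close>

definition transport_plan ::
  "('i \<Rightarrow> 'j \<Rightarrow> bool) \<Rightarrow> 'i set \<Rightarrow> 'j set \<Rightarrow> ('i \<Rightarrow> real) \<Rightarrow> ('j \<Rightarrow> real) \<Rightarrow> ('i \<Rightarrow> 'j \<Rightarrow> real) \<Rightarrow> bool"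
  where "transport_plan E I J a b p \<longleftrightarrow>
    (\<forall>i j. 0 \<le> p i j \<and> (p i j \<noteq> 0 \<longrightarrow> i \<in> I \<and> j \<in> J \<and> E i j)) \<and>
    (\<forall>i\<in>I. (\<Sum>j\<in>J. p i j) = a i) \<and> (\<forall>j\<in>J. (\<Sum>i\<in>I. p i j) \<le> b j)"

lemma transport_planD:
  assumes "transport_plan E I J a b p"
  shows "0 \<le> p i j" "p i j \<noteq> 0 \<Longrightarrow> i \<in> I \<and> j \<in> J \<and> E i j"
    "i \<in> I \<Longrightarrow> (\<Sum>j\<in>J. p i j) = a i" "j \<in> J \<Longrightarrow> (\<Sum>i\<in>I. p i j) \<le> b j"
  using assms unfolding transport_plan_def by blast+

lemma transport_planI:
  assumes "\<And>i j. 0 \<le> p i j" "\<And>i j. p i j \<noteq> 0 \<Longrightarrow> i \<in> I \<and> j \<in> J \<and> E i j"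
    "\<And>i. i \<in> I \<Longrightarrow> (\<Sum>j\<in>J. p i j) = a i" "\<And>j. j \<in> J \<Longrightarrow> (\<Sum>i\<in>I. p i j) \<le> b j"
  shows "transport_plan E I J a b p"
  using assms unfolding transport_plan_def by blast

text \<open>Weight is shifted along a single edge until something gives way. Either an endpoint is
  exhausted and can be deleted, or some set of rows becomes tight and the problem falls apart into
  two independent ones. All these cases decrease the number of vertices.\<close>

lemma fractional_hall:
  fixes a :: "'i \<Rightarrow> real" and b :: "'j \<Rightarrow> real"
  assumes "finite I" "finite J"
    and "\<And>i. i \<in> I \<Longrightarrow> 0 \<le> a i" "\<And>j. j \<in> J \<Longrightarrow> 0 \<le> b j"
    and "\<And>X. X \<subseteq> I \<Longrightarrow> sum a X \<le> sum b {j\<in>J. \<exists>i\<in>X. E i j}"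
  shows "\<exists>p. transport_plan E I J a b p"
  using assms
proof (induction "card I + card J" arbitrary: I J a b rule: less_induct)
  case less
  note fin = \<open>finite I\<close> \<open>finite J\<close>
  note a0 = less.prems(3) and b0 = less.prems(4) and hall = less.prems(5)
  define N where "N X = {j\<in>J. \<exists>i\<in>X. E i j}" for X
  have NJ: "N X \<subseteq> J" "finite (N X)" for X using fin by (auto simp: N_def)
  have N_Un: "N (X \<union> Y) = N X \<union> N Y" for X Y by (auto simp: N_def)
  show ?case
  proof (cases "\<exists>i\<in>I. a i = 0")
    case True
    then obtain i where i: "i \<in> I" "a i = 0" by blast
    have "card (I - {i}) + card J < card I + card J"
          using card_Diff1_less[of I i] i fin by linarith
    from less.hyps[OF this, of a b] obtain p where "transport_plan E (I - {i}) J a b p"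
      using fin a0 b0 hall by (auto simp: subset_iff)
    note p = transport_planD[OF this]
    have pi: "p i j = 0" for j using p(2)[of i j] by blast
    have "(\<Sum>j\<in>J. p k j) = a k" if "k \<in> I" for k
      using p(3)[of k] that pi i by (cases "k = i") auto
    moreover have "(\<Sum>k\<in>I. p k j) \<le> b j" if "j \<in> J" for j
      using p(4)[OF that] pi i fin by (simp add: sum.remove[of I i])
    ultimately show ?thesis using p(1,2) by (intro exI[of _ p] transport_planI) auto
  next
    case False
    show ?thesis
    proof (cases "I = {}")
      case True
      then show ?thesis using b0 by (intro exI[of _ "\<lambda>_ _. 0"] transport_planI) auto
    next
      case nonempty: False
      then obtain i where i: "i \<in> I" by blast
      have ai: "0 < a i" using False a0[OF i] i by force
      have "a i \<le> sum b (N {i})" using hall[of "{i}"] i by (simp add: N_def)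
      then obtain j where j: "j \<in> N {i}" "0 < b j"
        using ai b0 NJ(1) by (metis not_less order_less_le_trans sum_nonpos)
      have jJ: "j \<in> J" and Eij: "E i j" using j(1) by (auto simp: N_def)
      text \<open>Move as much weight along the edge \<open>(i, j)\<close> as Hall's condition allows: then \<open>i\<close> or \<open>j\<close> is
        exhausted, or Hall's condition has become an equality for some \<open>X\<close>.\<close>
      define A where "A = {X \<in> Pow I. i \<notin> X \<and> j \<in> N X}"
      define t where "t = Min ({a i, b j} \<union> (\<lambda>X. sum b (N X) - sum a X) ` A)"
      have finA: "finite A" unfolding A_def using fin by simp
      have tle: "t \<le> a i" "t \<le> b j" and tA: "\<And>X. X \<in> A \<Longrightarrow> t \<le> sum b (N X) - sum a X"
        unfolding t_def by (intro Min_le; use finA in force)+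
      have t_in: "t \<in> {a i, b j} \<union> (\<lambda>X. sum b (N X) - sum a X) ` A"
        unfolding t_def using finA by (intro Min_in) auto
      have t0: "0 \<le> t"
        using t_in ai j(2) hall by (auto simp: A_def N_def[symmetric])
      define a' where "a' = a(i := a i - t)"
      define b' where "b' = b(j := b j - t)"
      have a'0: "0 \<le> a' k" if "k \<in> I" for k using that a0 tle by (auto simp: a'_def)
      have b'0: "0 \<le> b' k" if "k \<in> J" for k using that b0 tle by (auto simp: b'_def)
      have suma': "sum a' X = sum a X - (if i \<in> X then t else 0)" if "finite X" for X
        using that by (auto simp: a'_def sum.remove[of X i] intro!: sum.cong)
      have sumb': "sum b' X = sum b X - (if j \<in> X then t else 0)" if "finite X" for X
        using that by (auto simp: b'_def sum.remove[of X j] intro!: sum.cong)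
      \<comment> \<open>The right side drops by \<open>t\<close> exactly when \<open>j\<close> is in
        \<open>N X\<close>. If \<open>i\<close> is in \<open>X\<close>, then \<open>j\<close> is in
        \<open>N X\<close> and both sides drop together; the sets where only the right side drops
        are those in \<open>A\<close>, for which \<open>t\<close> was bounded.\<close>
      have hall': "sum a' X \<le> sum b' (N X)" if X: "X \<subseteq> I" for X
      proof -
        have fX: "finite X" using X fin finite_subset by blast
        show ?thesis
          using hall[OF X] tA[of X] t0 X j(1)
          by (auto simp: suma'[OF fX] sumb'[OF NJ(2)] A_def N_def[symmetric] split: if_splits)
      qed
      have extend: ?thesis if "transport_plan E I J a' b' p" for p
      proof -
        note p = transport_planD[OF that]
        define p' where "p' k l = p k l + (if k = i \<and> l = j then t else 0)" for k l
        have "(\<Sum>l\<in>J. p' k l) = a k" if "k \<in> I" for k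
          using p(3)[OF that] jJ fin
          by (cases "k = i") (auto simp: p'_def sum.distrib a'_def)
        moreover have "(\<Sum>k\<in>I. p' k l) \<le> b l" if "l \<in> J" for l
          using p(4)[OF that] i fin
          by (cases "l = j") (auto simp: p'_def sum.distrib b'_def)
        ultimately show ?thesis
          using p(1,2) t0 i jJ Eij
          by (intro exI[of _ p'] transport_planI) (auto simp: p'_def split: if_splits)
      qed
      from t_in consider "t = a i" | "t = b j" | X where "X \<in> A" "t = sum b (N X) - sum a X" by blast
      then show ?thesis
      proof cases
        case 1
        then have a'i: "a' i = 0" by (simp add: a'_def)
        have "card (I - {i}) + card J < card I + card J"
          using card_Diff1_less[of I i] i fin by linarith
        from less.hyps[OF this, of a' b'] obtain p where "transport_plan E (I - {i}) J a' b' p"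
          using fin a'0 b'0 hall' by (auto simp: subset_iff N_def)
        note p = transport_planD[OF this]
        have pi: "p i l = 0" for l using p(2)[of i l] by blast
        have "(\<Sum>l\<in>J. p k l) = a' k" if "k \<in> I" for k
          using p(3)[of k] that pi a'i by (cases "k = i") auto
        moreover have "(\<Sum>k\<in>I. p k l) \<le> b' l" if "l \<in> J" for l
          using p(4)[OF that] pi i fin by (simp add: sum.remove[of I i])
        ultimately show ?thesis using p(1,2) by (intro extend[of p] transport_planI) auto
      next
        case 2
        then have b'j: "b' j = 0" by (simp add: b'_def)
        have hallj: "sum a' X \<le> sum b' {l \<in> J - {j}. \<exists>k\<in>X. E k l}" if X: "X \<subseteq> I" for X
        proof -
          have "{l \<in> J - {j}. \<exists>k\<in>X. E k l} = N X - {j}" by (auto simp: N_def)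
          then show ?thesis using hall'[OF X] b'j NJ(2) by (simp add: sum_diff1)
        qed
        have "card I + card (J - {j}) < card I + card J"
          using card_Diff1_less[of J j] jJ fin by linarith
        from less.hyps[OF this, of a' b'] obtain p where "transport_plan E I (J - {j}) a' b' p"
          using fin a'0 b'0 hallj by auto
        note p = transport_planD[OF this]
        have pj: "p k j = 0" for k using p(2)[of k j] by blast
        have "(\<Sum>l\<in>J. p k l) = a' k" if "k \<in> I" for k
          using p(3)[OF that] pj jJ fin by (simp add: sum.remove[of J j])
        moreover have "(\<Sum>k\<in>I. p k l) \<le> b' l" if "l \<in> J" for l
          using p(4)[of l] that pj b'j by (cases "l = j") auto
        ultimately show ?thesis using p(1,2) by (intro extend[of p] transport_planI) auto
      next
        case 3
        text \<open>The set \<open>X\<close> is tight for \<open>a'\<close> and \<open>b'\<close>, so the problem splits into two smaller ones.\<close>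
        have XI: "X \<subseteq> I" "i \<notin> X" "j \<in> N X" using 3(1) by (auto simp: A_def)
        have fX: "finite X" using XI fin finite_subset by blast
        have tight: "sum b' (N X) = sum a' X"
          using 3(2) XI by (simp add: suma'[OF fX] sumb'[OF NJ(2)])
        have Xne: "X \<noteq> {}" using XI(3) by (auto simp: N_def)
        have cX: "card X < card I" using XI i fin by (intro psubset_card_mono) auto
        have cX': "card (I - X) < card I" using XI Xne fin by (intro psubset_card_mono) auto
        have "card X + card (N X) < card I + card J"
          using cX card_mono[OF fin(2) NJ(1)[of X]] by linarith
        moreover have "{l \<in> N X. \<exists>k\<in>Y. E k l} = N Y" if "Y \<subseteq> X" for Y using that by (auto simp: N_def)
        ultimately obtain p where "transport_plan E X (N X) a' b' p"
          using less.hyps[of X "N X" a' b'] fX NJ a'0 b'0 hall' XI(1) by (auto simp: subset_iff)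
        note p = transport_planD[OF this]
        \<comment> \<open>Hall's condition for the remaining rows and columns is that for
          \<open>X \<union> Y\<close> minus the equality for \<open>X\<close>: the neighbours of
          \<open>Y\<close> outside \<open>N X\<close> are what \<open>Y\<close> adds to
          \<open>N X\<close>.\<close>
        have hallq: "sum a' Y \<le> sum b' {l \<in> J - N X. \<exists>k\<in>Y. E k l}" if Y: "Y \<subseteq> I - X" for Y
        proof -
          have fY: "finite Y" using Y fin finite_subset by blast
          have "{l \<in> J - N X. \<exists>k\<in>Y. E k l} = N (X \<union> Y) - N X" by (auto simp: N_def)
          then have "sum b' {l \<in> J - N X. \<exists>k\<in>Y. E k l} = sum b' (N (X \<union> Y)) - sum b' (N X)"
            using NJ(2) by (simp add: sum_diff N_Un)
          moreover have "sum a' (X \<union> Y) = sum a' X + sum a' Y"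
            using fX fY Y by (intro sum.union_disjoint) auto
          moreover have "sum a' (X \<union> Y) \<le> sum b' (N (X \<union> Y))" using XI Y by (intro hall') auto
          ultimately show ?thesis using tight by linarith
        qed
        have "card (I - X) + card (J - N X) < card I + card J"
          using cX' card_mono[OF fin(2), of "J - N X"] by auto
        from less.hyps[OF this, of a' b'] obtain q where "transport_plan E (I - X) (J - N X) a' b' q"
          using fin a'0 b'0 hallq by auto
        note q = transport_planD[OF this]
        have pz: "p k l = 0" if "k \<notin> X \<or> l \<notin> N X" for k l using p(2)[of k l] that by blast
        have qz: "q k l = 0" if "k \<in> X \<or> l \<in> N X" for k l using q(2)[of k l] that by blast
        have splitJ: "sum f J = sum f (N X) + sum f (J - N X)" for f :: "'j \<Rightarrow> real"
          using sum.subset_diff[OF NJ(1) fin(2), of f X] by simp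
        have splitI: "sum f I = sum f X + sum f (I - X)" for f :: "'i \<Rightarrow> real"
          using sum.subset_diff[OF XI(1) fin(1), of f] by simp
        define w where "w k l = p k l + q k l" for k l
        have "(\<Sum>l\<in>J. w k l) = a' k" if "k \<in> I" for k
          using that p(3)[of k] q(3)[of k] by (cases "k \<in> X") (simp_all add: w_def splitJ pz qz)
        moreover have "(\<Sum>k\<in>I. w k l) \<le> b' l" if "l \<in> J" for l
          using that p(4)[of l] q(4)[of l] by (cases "l \<in> N X") (simp_all add: w_def splitI pz qz)
        moreover have "0 \<le> w k l" for k l using p(1) q(1) by (simp add: w_def)
        moreover have "k \<in> I \<and> l \<in> J \<and> E k l" if "w k l \<noteq> 0" for k l
        proof -
          have "p k l \<noteq> 0 \<or> q k l \<noteq> 0" using that by (auto simp: w_def)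
          then show ?thesis using p(2)[of k l] q(2)[of k l] XI(1) NJ(1)[of X] by blast
        qed
        ultimately show ?thesis by (intro extend[of w] transport_planI) auto
      qed
    qed
  qed
qed

subsection \<open>Limits of random bit sequences\<close>

text \<open>Diagonal argument: compactness of the interval treats one index at a time, and the
  diagonal sequence is eventually a subsequence of each of the nested ones.\<close>

lemma convergent_subseq_countable:
  fixes f :: "'i::countable \<Rightarrow> nat \<Rightarrow> real"
  assumes "\<And>i n. f i n \<in> {l..u}"
  shows "\<exists>s. strict_mono s \<and> (\<forall>i. convergent (\<lambda>n. f i (s n)))"
proof -
  let ?P = "\<lambda>k s. convergent (\<lambda>n. f (from_nat k) (s n))"
  interpret subseqs ?P
  proof
    fix k and s :: "nat \<Rightarrow> nat" assume "strict_mono s"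
    have "seq_compact {l..u}" using compact_Icc compact_imp_seq_compact by blast
    then obtain x r where "strict_mono r" "((\<lambda>n. f (from_nat k) (s n)) \<circ> r) \<longlonglongrightarrow> x"
      using assms by (metis seq_compactE)
    then show "\<exists>r. strict_mono r \<and> ?P k (s \<circ> r)" by (auto simp: convergent_def o_def)
  qed
  have "convergent (\<lambda>n. f i (diagseq n))" for i
  proof -
    \<comment> \<open>The property of index \<open>k\<close> is only guaranteed for the diagonal
      sequence from position \<open>Suc k\<close> on, hence the shift, which is removed again in the
      limit.\<close>
    have "?P (to_nat i) (diagseq \<circ> (+) (Suc (to_nat i)))"
      by (rule diagseq_holds) (auto simp: o_def dest: convergent_subseq_convergent)
    then have "convergent (\<lambda>n. f i (diagseq (n + Suc (to_nat i))))" by (simp add: o_def add.commute)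
    then obtain l where "(\<lambda>n. f i (diagseq (n + Suc (to_nat i)))) \<longlonglongrightarrow> l" by (blast dest: convergentD)
    then have "(\<lambda>n. f i (diagseq n)) \<longlonglongrightarrow> l" by (rule LIMSEQ_offset)
    then show ?thesis by (rule convergentI)
  qed
  then show ?thesis using subseq_diagseq by blast
qed

text \<open>The words index nested intervals of length \<open>q a\<close> in \<open>[0, 1)\<close> with left endpoints \<open>L a\<close>;
  the bits of a uniformly distributed point are read off from the intervals that contain it.\<close>

lemma random_bits_exist:
  fixes q :: "bool list \<Rightarrow> real"
  assumes q_Nil: "q [] = 1" and q_nonneg: "\<And>a. 0 \<le> q a"
    and q_add: "\<And>a. q a = q (a @ [False]) + q (a @ [True])"
  shows "\<exists>(M :: real measure) B. prob_space M \<and> (\<forall>k. Measurable.pred M (\<lambda>\<omega>. B \<omega> k)) \<and>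
    (\<forall>a. measure M {\<omega>\<in>space M. map (B \<omega>) [0..<length a] = a} = q a)"
proof -
  \<comment> \<open>\<open>L a\<close> is the total mass of the words of the same length that
    precede \<open>a\<close> lexicographically, grouped by the first position \<open>k\<close> at
    which they differ from \<open>a\<close>.\<close>
  define L where "L a = (\<Sum>k<length a. if a ! k then q (take k a @ [False]) else 0)" for a
  \<comment> \<open>The word of \<omega> grows by one bit at a time. The current interval is cut at
    \<open>L a + q (a @ [False])\<close>, and the new bit tells whether \<omega> lies in the right
    piece.\<close>
  define w where "w = rec_nat (\<lambda>_. []) (\<lambda>n v \<omega>. v \<omega> @ [L (v \<omega>) + q (v \<omega> @ [False]) \<le> \<omega>])"
  have w_0: "w 0 \<omega> = []" and w_Suc: "w (Suc n) \<omega> = w n \<omega> @ [L (w n \<omega>) + q (w n \<omega> @ [False]) \<le> \<omega>]" for n \<omega>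
    by (simp_all add: w_def)
  have len: "length (w n \<omega>) = n" for n \<omega>
    by (induction n) (simp_all add: w_0 w_Suc)
  have L_snoc: "L (a @ [x]) = L a + (if x then q (a @ [False]) else 0)" for a x
    by (auto simp: L_def nth_append intro!: sum.cong)
  \<comment> \<open>Half-open intervals make the words of each length partition
    \<open>[0, 1)\<close>, and a word of mass zero gets the empty interval, so null words never
    occur.\<close>
  have w_eq: "w n \<omega> = a \<longleftrightarrow> length a = n \<and> L a \<le> \<omega> \<and> \<omega> < L a + q a" if "0 \<le> \<omega>" "\<omega> < 1" for n \<omega> a
  proof (induction n arbitrary: a)
    case 0
    then show ?case using that by (auto simp: w_0 L_def q_Nil)
  next
    case (Suc n)
    show ?case
    proof (cases a rule: rev_cases)
      case Nil
      then show ?thesis by (simp add: w_Suc)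
    next
      case (snoc c x)
      have "w (Suc n) \<omega> = a \<longleftrightarrow> w n \<omega> = c \<and> (x \<longleftrightarrow> L c + q (c @ [False]) \<le> \<omega>)"
        by (auto simp: snoc w_Suc)
      then show ?thesis
        using q_add[of c] q_nonneg[of "c @ [True]"] q_nonneg[of "c @ [False]"]
        unfolding Suc.IH by (cases x) (auto simp: snoc L_snoc)
    qed
  qed
  define B where "B \<omega> k = last (w (Suc k) \<omega>)" for \<omega> k
  have w_B: "map (B \<omega>) [0..<n] = w n \<omega>" for n \<omega>
    by (induction n) (simp_all add: w_0 B_def w_Suc)
  define M :: "real measure" where "M = uniform_measure lborel {0..<1}"
  have "prob_space M" unfolding M_def by (rule prob_space_uniform_measure) auto
  have w_meas: "w n \<in> M \<rightarrow>\<^sub>M count_space UNIV" for n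
  proof (induction n)
    case 0
    then show ?case by (simp add: w_def)
  next
    case (Suc n)
    have "(\<lambda>\<omega>. v @ [L v + q (v @ [False]) \<le> \<omega>]) \<in> M \<rightarrow>\<^sub>M count_space UNIV" for v
      unfolding M_def by measurable
    from measurable_compose_countable[OF this Suc] show ?case unfolding w_Suc[abs_def] .
  qed
  have "Measurable.pred M (\<lambda>\<omega>. B \<omega> k)" for k
    unfolding B_def using w_meas[of "Suc k"] by measurable
  moreover have "measure M {\<omega>\<in>space M. map (B \<omega>) [0..<length a] = a} = q a" for a
  proof -
    let ?I = "{\<omega>. 0 \<le> \<omega> \<and> \<omega> < 1 \<and> L a \<le> \<omega> \<and> \<omega> < L a + q a}"
    have L0: "0 \<le> L a" unfolding L_def by (intro sum_nonneg) (simp add: q_nonneg)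
    have L1: "L a + q a \<le> 1"
    proof (induction a rule: rev_induct)
      case (snoc x a)
      then show ?case
        using q_add[of a] q_nonneg[of "a @ [True]"] by (cases x) (auto simp: L_snoc)
    qed (simp add: L_def q_Nil)
    have "{\<omega>\<in>space M. w (length a) \<omega> = a} \<in> sets M"
      using w_meas[of "length a"] by measurable
    then have "{\<omega>. w (length a) \<omega> = a} \<in> sets borel"
      by (simp add: M_def)
    then have "measure M {\<omega>\<in>space M. w (length a) \<omega> = a} = measure lborel ({0..<1} \<inter> {\<omega>. w (length a) \<omega> = a})"
      by (subst M_def, subst measure_uniform_measure) (auto simp: M_def)
    also have "{0..<1} \<inter> {\<omega>. w (length a) \<omega> = a} = {L a..<L a + q a}"
      using L0 L1 w_eq[of _ "length a" a] by force
    finally show ?thesis using q_nonneg by (simp add: w_B)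
  qed
  ultimately show ?thesis using \<open>prob_space M\<close> by blast
qed

text \<open>An event about the first \<open>n\<close> bits is a finite disjoint union of cylinders,
  so limits of cylinder masses determine the limits of all such events.\<close>

lemma measure_prefix_sum:
  fixes b :: "'z \<Rightarrow> nat \<Rightarrow> bool"
  assumes "prob_space M" and [measurable]: "\<And>k. Measurable.pred M (\<lambda>z. b z k)"
  shows "measure M {z\<in>space M. map (b z) [0..<n] \<in> A} =
    (\<Sum>a\<in>{a\<in>A. length a = n}. measure M {z\<in>space M. map (b z) [0..<length a] = a})"
proof -
  interpret prob_space M by fact
  have meas: "{z\<in>space M. map (b z) [0..<n] = a} \<in> sets M" for n a
  proof (induction n arbitrary: a)
    case (Suc n)
    have "{z\<in>space M. map (b z) [0..<Suc n] = a} =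
        (if a = [] then {} else {z\<in>space M. map (b z) [0..<n] = butlast a} \<inter> {z\<in>space M. b z n = last a})"
      by (cases a rule: rev_cases) auto
    moreover have "{z\<in>space M. b z n = last a} \<in> sets M" by measurable
    ultimately show ?case using Suc by auto
  qed auto
  have "finite {a::bool list. set a \<subseteq> UNIV \<and> length a = n}" by (rule finite_lists_length_eq) simp
  then have fin: "finite {a\<in>A. length a = n}" by (rule rev_finite_subset) auto
  have "{z\<in>space M. map (b z) [0..<n] \<in> A} =
    (\<Union>a\<in>{a\<in>A. length a = n}. {z\<in>space M. map (b z) [0..<length a] = a})"
    by auto
  also have "measure M \<dots> = (\<Sum>a\<in>{a\<in>A. length a = n}. measure M {z\<in>space M. map (b z) [0..<length a] = a})"
    by (rule finite_measure_finite_Union) (use fin meas in \<open>auto simp: disjoint_family_on_def\<close>)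
  finally show ?thesis .
qed

text \<open>There are only countably many words, so one subsequence makes all cylinder masses
  converge. Normalisation, nonnegativity and additivity pass to the limits, which are therefore the
  cylinder masses of a random bit sequence.\<close>

lemma random_bits_limit:
  fixes Q :: "nat \<Rightarrow> 'z measure" and b :: "'z \<Rightarrow> nat \<Rightarrow> bool"
  assumes prob: "\<And>n. prob_space (Q n)" and meas: "\<And>n k. Measurable.pred (Q n) (\<lambda>z. b z k)"
  obtains s and M :: "real measure" and B where
    "strict_mono s" "prob_space M" "\<And>k. Measurable.pred M (\<lambda>\<omega>. B \<omega> k)"
    "\<And>n A. (\<lambda>j. measure (Q (s j)) {z\<in>space (Q (s j)). map (b z) [0..<n] \<in> A})
       \<longlonglongrightarrow> measure M {\<omega>\<in>space M. map (B \<omega>) [0..<n] \<in> A}"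
proof -
  define f where "f a n = measure (Q n) {z\<in>space (Q n). map (b z) [0..<length a] = a}" for a n
  have "f a n \<in> {0..1}" for a n
    using prob_space.prob_le_1[OF prob] by (simp add: f_def)
  from convergent_subseq_countable[of f, OF this] obtain s where
    s: "strict_mono s" "\<And>a. convergent (\<lambda>n. f a (s n))" by blast
  then obtain q where q: "\<And>a. (\<lambda>n. f a (s n)) \<longlonglongrightarrow> q a"
    unfolding convergent_def by metis
  have f_Nil: "f [] n = 1" for n using prob_space.prob_space[OF prob] by (simp add: f_def)
  have f_add: "f a n = f (a @ [False]) n + f (a @ [True]) n" for a n
  proof -
    have "f a n = measure (Q n) {z\<in>space (Q n). map (b z) [0..<Suc (length a)] \<in> {a @ [False], a @ [True]}}"
      by (auto simp: f_def intro!: arg_cong[where f = "measure (Q n)"])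
    also have "\<dots> = (\<Sum>c\<in>{c\<in>{a @ [False], a @ [True]}. length c = Suc (length a)}. f c n)"
      unfolding f_def by (rule measure_prefix_sum[OF prob meas])
    also have "{c\<in>{a @ [False], a @ [True]}. length c = Suc (length a)} = {a @ [False], a @ [True]}"
      by auto
    finally show ?thesis by simp
  qed
  have "q [] = 1" using q[of "[]"] by (simp add: f_Nil LIMSEQ_const_iff)
  moreover have "0 \<le> q a" for a
    using q[of a] by (rule LIMSEQ_le_const) (simp add: f_def)
  moreover have "q a = q (a @ [False]) + q (a @ [True])" for a
  proof (rule LIMSEQ_unique[OF q])
    show "(\<lambda>n. f a (s n)) \<longlonglongrightarrow> q (a @ [False]) + q (a @ [True])"
      unfolding f_add[of a] by (intro tendsto_intros q)
  qed
  ultimately obtain M :: "real measure" and B where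
    M: "prob_space M" "\<And>k. Measurable.pred M (\<lambda>\<omega>. B \<omega> k)"
      "\<And>a. measure M {\<omega>\<in>space M. map (B \<omega>) [0..<length a] = a} = q a"
    using random_bits_exist[of q] by blast
  have "(\<lambda>j. measure (Q (s j)) {z\<in>space (Q (s j)). map (b z) [0..<n] \<in> A})
       \<longlonglongrightarrow> measure M {\<omega>\<in>space M. map (B \<omega>) [0..<n] \<in> A}" for n A
    unfolding measure_prefix_sum[OF prob meas] measure_prefix_sum[OF M(1,2)] M(3)
    using q unfolding f_def by (intro tendsto_sum)
  then show ?thesis using that s M by blast
qed

subsection \<open>Compactness of the set of couplings\<close>

abbreviation bit_space :: "(nat \<Rightarrow> bool) measure" where
  "bit_space \<equiv> Pi\<^sub>M UNIV (\<lambda>_. count_space UNIV)"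

text \<open>The base consists of the balls of radius \<open>1 / 2 ^ m\<close> about a countable
  dense set. Decoding takes, for each \<open>m\<close>, the centre of the first ball of that radius
  whose bit is set; for the bits of a point these centres converge to the point.\<close>

lemma polish_base_decoder:
  obtains U :: "nat \<Rightarrow> 'a::polish_space set" and g :: "(nat \<Rightarrow> bool) \<Rightarrow> 'a"
  where "\<And>k. open (U k)" "\<And>V x. open V \<Longrightarrow> x \<in> V \<Longrightarrow> \<exists>k. x \<in> U k \<and> U k \<subseteq> V"
    "g \<in> bit_space \<rightarrow>\<^sub>M borel" "\<And>x. g (\<lambda>k. x \<in> U k) = x"
proof -
  obtain D :: "'a set" where D: "countable D" "\<And>X. open X \<Longrightarrow> X \<noteq> {} \<Longrightarrow> \<exists>d\<in>D. d \<in> X"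
    using countable_dense_exists by blast
  have "D \<noteq> {}" using D(2)[of UNIV] by auto
  define d where "d = from_nat_into D"
  have dense: "\<exists>i. dist (d i) x < e" if pos: "0 < e" for x e
  proof -
    obtain y where y: "y \<in> D" "y \<in> ball x e" using D(2)[of "ball x e"] pos by force
    then obtain i where "d i = y" unfolding d_def using from_nat_into_surj[OF D(1)] by blast
    then show ?thesis using y by (auto simp: dist_commute)
  qed
  define U where "U k = (case prod_decode k of (i, m) \<Rightarrow> ball (d i) (1 / 2 ^ m))" for k
  have U: "x \<in> U (prod_encode (i, m)) \<longleftrightarrow> dist (d i) x < 1 / 2 ^ m" for x i m
    by (simp add: U_def)
  have small: "\<exists>m. 1 / 2 ^ m < e" if "0 < e" for e :: real
    using real_arch_pow_inv[OF that, of "1/2"] by (auto simp: power_one_over)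
  define u where "u m c = d (LEAST i. c (prod_encode (i, m)))" for m and c :: "nat \<Rightarrow> bool"
  have u_meas[measurable]: "u m \<in> borel_measurable bit_space" for m
  proof -
    have "(\<lambda>c. LEAST i. c (prod_encode (i, m))) \<in> bit_space \<rightarrow>\<^sub>M count_space UNIV"
      by measurable
    then show ?thesis unfolding u_def by measurable
  qed
  \<comment> \<open>Bit sequences that code no point may give centres without a limit; the fixed
    value \<open>d 0\<close> there makes \<open>g\<close> an everywhere pointwise limit of
    measurable functions.\<close>
  define g where "g c = (if Cauchy (\<lambda>m. u m c) then lim (\<lambda>m. u m c) else d 0)" for c
  have "g \<in> borel_measurable bit_space"
  proof (rule borel_measurable_LIMSEQ_metric)
    show "(\<lambda>c. if Cauchy (\<lambda>m. u m c) then u m c else d 0) \<in> borel_measurable bit_space" for m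
      by measurable
    show "(\<lambda>m. if Cauchy (\<lambda>m. u m c) then u m c else d 0) \<longlonglongrightarrow> g c" for c
      by (auto simp: g_def Cauchy_convergent_iff convergent_LIMSEQ_iff)
  qed
  moreover have "g (\<lambda>k. x \<in> U k) = x" for x
  proof -
    have "dist (u m (\<lambda>k. x \<in> U k)) x < 1 / 2 ^ m" for m
      unfolding u_def U by (rule LeastI_ex) (simp add: dense)
    then have "(\<lambda>m. dist (u m (\<lambda>k. x \<in> U k)) x) \<longlonglongrightarrow> 0"
      by (intro real_tendsto_sandwich[OF _ _ tendsto_const LIMSEQ_divide_realpow_zero[of 2 1]] always_eventually)
         (auto intro: less_imp_le)
    then have "(\<lambda>m. u m (\<lambda>k. x \<in> U k)) \<longlonglongrightarrow> x"
      by (rule tendsto_dist_iff[THEN iffD2])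
    then show ?thesis by (auto simp: g_def limI LIMSEQ_imp_Cauchy)
  qed
  moreover have "open (U k)" for k by (simp add: U_def split: prod.split)
  moreover have "\<exists>k. x \<in> U k \<and> U k \<subseteq> V" if "open V" "x \<in> V" for V x
  proof -
    obtain e where e: "0 < e" "ball x e \<subseteq> V" using \<open>open V\<close> \<open>x \<in> V\<close> by (rule openE)
    obtain m where m: "1 / 2 ^ m < e / 2" using small[of "e / 2"] e by auto
    obtain i where i: "dist (d i) x < 1 / 2 ^ m" using dense by fastforce
    have "U (prod_encode (i, m)) \<subseteq> ball x e"
    proof
      fix y assume "y \<in> U (prod_encode (i, m))"
      then show "y \<in> ball x e"
        using m i dist_triangle2[of x y "d i"] dist_triangle[of x y "d i"] by (simp add: U dist_commute)
    qed
    then show ?thesis using e i U by blast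
  qed
  ultimately show ?thesis using that by blast
qed

text \<open>A coupling seen as a joint law on the product space, in which limits, densities and
  mixtures can be formed directly. \<open>order_prob_couplings\<close> translates back to pairs of
  random variables.\<close>

definition coupling_measure :: "'a::polish_space measure \<Rightarrow> 'a measure \<Rightarrow> ('a \<times> 'a) measure \<Rightarrow> bool" where
  "coupling_measure \<mu> \<nu> Q \<longleftrightarrow>
    sets Q = sets borel \<and> distr Q borel fst = \<mu> \<and> distr Q borel snd = \<nu>"

text \<open>\<open>h\<close> selects the bits that encode one coordinate. Their joint law is the
  same for every \<open>Q n\<close>, because the marginal is always \<mu>, so the limiting bits have
  that law too and decode to a point with law \<mu>.\<close>

lemma bits_marginal_limit:
  fixes U :: "nat \<Rightarrow> 'a::polish_space set" and M :: "'w measure" and h :: "nat \<Rightarrow> nat"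
  assumes U: "\<And>k. open (U k)"
    and g: "g \<in> bit_space \<rightarrow>\<^sub>M borel" "\<And>x. g (\<lambda>k. x \<in> U k) = x"
    and \<mu>: "prob_space \<mu>" "sets \<mu> = sets borel"
    and pr: "\<And>n. \<pi> \<in> Q n \<rightarrow>\<^sub>M borel" "\<And>n. distr (Q n) borel \<pi> = \<mu>"
    and b: "\<And>z k. b z (h k) \<longleftrightarrow> \<pi> z \<in> U k"
    and M: "prob_space M" "\<And>k. Measurable.pred M (\<lambda>\<omega>. B \<omega> k)"
    and lim: "\<And>n A. (\<lambda>j. measure (Q j) {z\<in>space (Q j). map (b z) [0..<n] \<in> A})
       \<longlonglongrightarrow> measure M {\<omega>\<in>space M. map (B \<omega>) [0..<n] \<in> A}"
  defines "X \<equiv> \<lambda>\<omega>. g (\<lambda>k. B \<omega> (h k))"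
  shows "X \<in> M \<rightarrow>\<^sub>M borel" "distr M borel X = \<mu>" "AE \<omega> in M. \<forall>k. X \<omega> \<in> U k \<longleftrightarrow> B \<omega> (h k)"
proof -
  interpret M: prob_space M by fact
  interpret \<mu>: prob_space \<mu> by fact
  note [measurable] = M(2) pr(1) g(1) borel_open[OF U]
  have space_\<mu>: "space \<mu> = UNIV" using \<mu>(2) by (metis sets_eq_imp_space_eq space_borel)
  have f[measurable]: "(\<lambda>x k. x \<in> U k) \<in> \<mu> \<rightarrow>\<^sub>M bit_space"
    using \<mu>(2) by (intro measurable_PiM_single') (auto simp: measurable_cong_sets[OF \<mu>(2) refl])
  have B[measurable]: "(\<lambda>\<omega> k. B \<omega> (h k)) \<in> M \<rightarrow>\<^sub>M bit_space"
    by (intro measurable_PiM_single') auto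
  \<comment> \<open>Laws on \<open>bit_space\<close> are determined by finite-dimensional cylinders.
    Each of these is an event about a finite prefix, and its mass is constant along the
    sequence.\<close>
  have law: "distr M bit_space (\<lambda>\<omega> k. B \<omega> (h k)) = distr \<mu> bit_space (\<lambda>x k. x \<in> U k)"
  proof (rule measure_eqI_PiM_infinite)
    fix A :: "nat \<Rightarrow> bool set" and J :: "nat set" assume J: "finite J"
    let ?C = "prod_emb UNIV (\<lambda>_. count_space UNIV) J (Pi\<^sub>E J A)"
    have C: "?C = {c. \<forall>k\<in>J. c k \<in> A k}" by (auto simp: prod_emb_def PiE_iff)
    have C_sets: "?C \<in> sets bit_space" using J by (intro sets_PiM_I) auto
    obtain n where n: "\<And>k. k \<in> J \<Longrightarrow> h k < n"
      using J finite_nat_set_iff_bounded[of "h ` J"] by auto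
    let ?A = "{a. \<forall>k\<in>J. a ! h k \<in> A k}"
    have "measure (Q j) {z\<in>space (Q j). map (b z) [0..<n] \<in> ?A} = measure \<mu> {x. \<forall>k\<in>J. (x \<in> U k) \<in> A k}" for j
    proof -
      have "{x\<in>space borel. \<forall>k\<in>J. (x \<in> U k) \<in> A k} \<in> sets borel" using J by measurable
      then have "measure \<mu> {x. \<forall>k\<in>J. (x \<in> U k) \<in> A k}
          = measure (Q j) (\<pi> -` {x. \<forall>k\<in>J. (x \<in> U k) \<in> A k} \<inter> space (Q j))"
        unfolding pr(2)[of j, symmetric] by (intro measure_distr pr) auto
      also have "\<pi> -` {x. \<forall>k\<in>J. (x \<in> U k) \<in> A k} \<inter> space (Q j)
          = {z\<in>space (Q j). map (b z) [0..<n] \<in> ?A}"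
        using n by (auto simp: b)
      finally show ?thesis by simp
    qed
    then have "measure M {\<omega>\<in>space M. map (B \<omega>) [0..<n] \<in> ?A} = measure \<mu> {x. \<forall>k\<in>J. (x \<in> U k) \<in> A k}"
      using lim[of n ?A] by (simp add: LIMSEQ_const_iff)
    moreover have "(\<lambda>\<omega> k. B \<omega> (h k)) -` ?C \<inter> space M = {\<omega>\<in>space M. map (B \<omega>) [0..<n] \<in> ?A}"
      using n by (auto simp: C)
    moreover have "(\<lambda>x k. x \<in> U k) -` ?C \<inter> space \<mu> = {x. \<forall>k\<in>J. (x \<in> U k) \<in> A k}"
      by (auto simp: C space_\<mu>)
    ultimately show "emeasure (distr M bit_space (\<lambda>\<omega> k. B \<omega> (h k))) ?C
        = emeasure (distr \<mu> bit_space (\<lambda>x k. x \<in> U k)) ?C"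
      using C_sets by (simp add: emeasure_distr M.emeasure_eq_measure \<mu>.emeasure_eq_measure)
  qed (auto intro!: M.finite_measure_distr B)
  have "distr M borel X = distr (distr M bit_space (\<lambda>\<omega> k. B \<omega> (h k))) borel g"
    by (simp add: distr_distr X_def o_def)
  also have "\<dots> = distr \<mu> borel (\<lambda>x. x)"
    unfolding law by (simp add: distr_distr o_def g(2))
  also have "\<dots> = \<mu>" using \<mu>(2)[symmetric] by (rule distr_id2)
  finally show "distr M borel X = \<mu>" .
  show "X \<in> M \<rightarrow>\<^sub>M borel" unfolding X_def by measurable
  \<comment> \<open>That the bits are those of the decoded point depends only on their law; it is
    evident for the bits of a \<mu>-distributed point and so carries over to
    \<open>M\<close>.\<close>
  have "AE c in distr \<mu> bit_space (\<lambda>x k. x \<in> U k). \<forall>k. g c \<in> U k \<longleftrightarrow> c k"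
    by (subst AE_distr_iff) (auto simp: g(2))
  then show "AE \<omega> in M. \<forall>k. X \<omega> \<in> U k \<longleftrightarrow> B \<omega> (h k)"
    unfolding law[symmetric] by (subst (asm) AE_distr_iff) (auto simp: X_def)
qed

text \<open>Sequential compactness of the set of couplings, together with lower semicontinuity of
  \<open>Q \<mapsto> Q V\<close> for open \<open>V\<close>.\<close>

lemma coupling_limit:
  fixes U :: "nat \<Rightarrow> 'a::polish_space set" and Q :: "nat \<Rightarrow> ('a \<times> 'a) measure"
  assumes U: "\<And>k. open (U k)" "\<And>V x. open V \<Longrightarrow> x \<in> V \<Longrightarrow> \<exists>k. x \<in> U k \<and> U k \<subseteq> V"
    and g: "g \<in> bit_space \<rightarrow>\<^sub>M borel" "\<And>x. g (\<lambda>k. x \<in> U k) = x"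
    and \<mu>: "prob_space \<mu>" "sets \<mu> = sets borel" and \<nu>: "prob_space \<nu>" "sets \<nu> = sets borel"
    and Q: "\<And>n. coupling_measure \<mu> \<nu> (Q n)" and V: "open V"
    and le: "\<And>F e. finite F \<Longrightarrow> (\<Union>(i, j)\<in>F. U i \<times> U j) \<subseteq> V \<Longrightarrow> 0 < e \<Longrightarrow>
      \<forall>\<^sub>F n in sequentially. measure (Q n) (\<Union>(i, j)\<in>F. U i \<times> U j) \<le> c + e"
  shows "\<exists>R. coupling_measure \<mu> \<nu> R \<and> measure R V \<le> c"
proof -
  have sets_Q: "sets (Q n) = sets (borel \<Otimes>\<^sub>M borel)" for n
    unfolding borel_prod using Q by (simp add: coupling_measure_def)
  have space_Q: "space (Q n) = UNIV" for n
    using sets_eq_imp_space_eq[OF sets_Q] by (simp add: space_pair_measure)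
  have fst_Q: "fst \<in> Q n \<rightarrow>\<^sub>M borel" and snd_Q: "snd \<in> Q n \<rightarrow>\<^sub>M borel" for n
    by (simp_all add: measurable_cong_sets[OF sets_Q refl])
  have prob_Q: "prob_space (Q n)" for n
    using prob_space_distrD[OF fst_Q] \<mu>(1) Q by (simp add: coupling_measure_def)
  \<comment> \<open>The codes of the two coordinates are interleaved: even positions describe the
    first one, odd positions the second.\<close>
  define b where "b z k = (if even k then fst z \<in> U (k div 2) else snd z \<in> U (k div 2))" for z k
  have "Measurable.pred (Q n) (\<lambda>z. b z k)" for n k
    using fst_Q[of n] snd_Q[of n] borel_open[OF U(1)] unfolding b_def by measurable
  from random_bits_limit[of Q b, OF prob_Q this] obtain s M B where
    s: "strict_mono s" and M: "prob_space M" "\<And>k. Measurable.pred (M :: real measure) (\<lambda>\<omega>. B \<omega> k)"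
    and lim: "\<And>n A. (\<lambda>j. measure (Q (s j)) {z\<in>space (Q (s j)). map (b z) [0..<n] \<in> A})
       \<longlonglongrightarrow> measure M {\<omega>\<in>space M. map (B \<omega>) [0..<n] \<in> A}" by blast
  interpret M: prob_space M by fact
  define X where "X \<omega> = g (\<lambda>k. B \<omega> (2 * k))" for \<omega>
  define Y where "Y \<omega> = g (\<lambda>k. B \<omega> (2 * k + 1))" for \<omega>
  have X[measurable]: "X \<in> M \<rightarrow>\<^sub>M borel" and dX: "distr M borel X = \<mu>"
    and aeX: "AE \<omega> in M. \<forall>k. X \<omega> \<in> U k \<longleftrightarrow> B \<omega> (2 * k)"
    unfolding X_def[abs_def]
    using bits_marginal_limit[of U g \<mu> fst "\<lambda>j. Q (s j)" b "\<lambda>k. 2 * k", OF U(1) g \<mu> fst_Q _ _ M lim] Q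
    by (simp_all add: coupling_measure_def b_def)
  have Y[measurable]: "Y \<in> M \<rightarrow>\<^sub>M borel" and dY: "distr M borel Y = \<nu>"
    and aeY: "AE \<omega> in M. \<forall>k. Y \<omega> \<in> U k \<longleftrightarrow> B \<omega> (2 * k + 1)"
    unfolding Y_def[abs_def]
    using bits_marginal_limit[of U g \<nu> snd "\<lambda>j. Q (s j)" b "\<lambda>k. 2 * k + 1", OF U(1) g \<nu> snd_Q _ _ M lim] Q
    by (simp_all add: coupling_measure_def b_def)
  have XY: "(\<lambda>\<omega>. (X \<omega>, Y \<omega>)) \<in> M \<rightarrow>\<^sub>M borel" unfolding borel_prod[symmetric] by measurable
  define R where "R = distr M borel (\<lambda>\<omega>. (X \<omega>, Y \<omega>))"
  interpret R: prob_space R unfolding R_def by (rule M.prob_space_distr) (rule XY)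
  have R: "coupling_measure \<mu> \<nu> R"
    using XY dX dY by (simp add: coupling_measure_def R_def distr_distr o_def borel_measurable_continuous_onI continuous_on_fst continuous_on_snd continuous_on_id)
  have open_F: "open (\<Union>(i, j)\<in>F. U i \<times> U j)" for F
    using U(1) by (auto intro!: open_UN open_Times)
  have R_le: "measure R (\<Union>(i, j)\<in>F. U i \<times> U j) \<le> c"
    if F: "finite F" "(\<Union>(i, j)\<in>F. U i \<times> U j) \<subseteq> V" for F
  proof -
    let ?W = "\<Union>(i, j)\<in>F. U i \<times> U j"
    obtain m where m: "\<And>i j. (i, j) \<in> F \<Longrightarrow> i < m \<and> j < m"
    proof -
      obtain m where "\<forall>k\<in>fst ` F \<union> snd ` F. k < m"
        using F(1) finite_nat_set_iff_bounded[of "fst ` F \<union> snd ` F"] by auto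
      then show ?thesis using that[of m] by force
    qed
    \<comment> \<open>With all indices in \<open>F\<close> below \<open>m\<close>, the positions
      \<open>2 * i\<close> and \<open>2 * j + 1\<close> lie in the prefix of length
      \<open>2 * m\<close>.\<close>
    let ?A = "{a. \<exists>(i, j)\<in>F. a ! (2 * i) \<and> a ! (2 * j + 1)}"
    have A: "map f [0..<2 * m] \<in> ?A \<longleftrightarrow> (\<exists>(i, j)\<in>F. f (2 * i) \<and> f (2 * j + 1))" for f
    proof -
      have "map f [0..<2 * m] ! (2 * i) = f (2 * i)" "map f [0..<2 * m] ! (2 * j + 1) = f (2 * j + 1)"
        if "(i, j) \<in> F" for i j
        using m[OF that] by simp_all
      then show ?thesis by blast
    qed
    have "(\<lambda>\<omega>. (X \<omega>, Y \<omega>)) -` ?W \<inter> space M = {\<omega>\<in>space M. \<exists>(i, j)\<in>F. X \<omega> \<in> U i \<and> Y \<omega> \<in> U j}"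
      by (simp add: split_beta set_eq_iff conj_commute)
    then have "measure R ?W = measure M {\<omega>\<in>space M. \<exists>(i, j)\<in>F. X \<omega> \<in> U i \<and> Y \<omega> \<in> U j}"
      unfolding R_def using open_F[of F] by (subst measure_distr[OF XY]) simp_all
    \<comment> \<open>Off a null set, membership of the decoded points in base sets can be read off
      from the bits, which turns the rectangle event into one about a finite prefix, where
      \<open>lim\<close> applies.\<close>
    also have "\<dots> = measure M {\<omega>\<in>space M. map (B \<omega>) [0..<2 * m] \<in> ?A}"
    proof (rule M.finite_measure_eq_AE)
      show "AE \<omega> in M. (\<omega> \<in> {\<omega>\<in>space M. \<exists>(i, j)\<in>F. X \<omega> \<in> U i \<and> Y \<omega> \<in> U j}) =
          (\<omega> \<in> {\<omega>\<in>space M. map (B \<omega>) [0..<2 * m] \<in> ?A})"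
        using aeX aeY unfolding A by eventually_elim auto
      note [measurable] = M(2) borel_open[OF U(1)]
      show "{\<omega>\<in>space M. \<exists>(i, j)\<in>F. X \<omega> \<in> U i \<and> Y \<omega> \<in> U j} \<in> sets M"
        using F(1) unfolding split_beta by measurable
      show "{\<omega>\<in>space M. map (B \<omega>) [0..<2 * m] \<in> ?A} \<in> sets M"
        using F(1) unfolding A split_beta by measurable
    qed
    finally have R_eq: "measure R ?W = measure M {\<omega>\<in>space M. map (B \<omega>) [0..<2 * m] \<in> ?A}" .
    have "{z\<in>space (Q j). map (b z) [0..<2 * m] \<in> ?A} = ?W" for j
      unfolding A by (simp add: space_Q b_def split_beta set_eq_iff mem_Times_iff)
    then have conv: "(\<lambda>j. measure (Q (s j)) ?W) \<longlonglongrightarrow> measure R ?W"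
      using lim[of "2 * m" ?A] by (simp add: R_eq)
    show ?thesis
    proof (rule field_le_epsilon)
      fix e :: real assume "0 < e"
      then have "\<forall>\<^sub>F j in sequentially. measure (Q (s j)) ?W \<le> c + e"
        using eventually_subseq[OF s le[OF F]] by blast
      then show "measure R ?W \<le> c + e"
        using tendsto_upperbound[OF conv] by simp
    qed
  qed
  \<comment> \<open>Finite unions of base rectangles contained in \<open>V\<close> increase to
    \<open>V\<close>, so the bound reaches \<open>V\<close> by continuity from below.\<close>
  define W where "W m = (\<Union>(i, j)\<in>{(i, j). i < m \<and> j < m \<and> U i \<times> U j \<subseteq> V}. U i \<times> U j)" for m
  have "measure R (W m) \<le> c" for m
    unfolding W_def
    by (rule R_le) (auto intro: finite_subset[of _ "{..<m} \<times> {..<m}"])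
  moreover have "(\<lambda>m. measure R (W m)) \<longlonglongrightarrow> measure R (\<Union>m. W m)"
  proof (rule R.finite_Lim_measure_incseq)
    show "range W \<subseteq> sets R" using open_F by (auto simp: W_def R_def)
    show "incseq W" unfolding W_def incseq_def by (intro allI impI UN_mono) auto
  qed
  moreover have "(\<Union>m. W m) = V"
  proof
    show "V \<subseteq> (\<Union>m. W m)"
    proof
      fix z assume "z \<in> V"
      then obtain S T where ST: "open S" "open T" "z \<in> S \<times> T" "S \<times> T \<subseteq> V"
        using V by (metis open_prod_elim)
      obtain i where i: "fst z \<in> U i" "U i \<subseteq> S" using U(2)[OF ST(1), of "fst z"] ST(3) by auto
      obtain j where j: "snd z \<in> U j" "U j \<subseteq> T" using U(2)[OF ST(2), of "snd z"] ST(3) by auto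
      have "U i \<times> U j \<subseteq> V" using i j ST(4) by blast
      then have "z \<in> W (Suc (max i j))"
        unfolding W_def using i(1) j(1) by (intro UN_I[of "(i, j)"]) (auto simp: mem_Times_iff)
      then show "z \<in> (\<Union>m. W m)" by blast
    qed
  qed (auto simp: W_def)
  ultimately have "measure R V \<le> c" by (auto intro: LIMSEQ_le_const2)
  then show ?thesis using R by blast
qed

subsection \<open>Attainment of the maximum\<close>

lemma prob_measuresD:
  assumes "\<mu> \<in> prob_measures"
  shows "prob_space \<mu>" "sets \<mu> = sets borel" "space \<mu> = UNIV"
proof -
  show sets: "sets \<mu> = sets borel" using assms by (simp add: prob_measures_def finite_measures_def)
  then show space: "space \<mu> = UNIV" by (metis sets_eq_imp_space_eq space_borel)
  interpret finite_measure \<mu> using assms by (simp add: prob_measures_def finite_measures_def)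
  show "prob_space \<mu>"
    using assms space by (intro prob_spaceI) (simp add: prob_measures_def emeasure_eq_measure)
qed

lemma prob_measuresI: "prob_space \<mu> \<Longrightarrow> sets \<mu> = sets borel \<Longrightarrow> \<mu> \<in> prob_measures"
  using sets_eq_imp_space_eq[of \<mu> borel] prob_space.prob_space[of \<mu>]
  by (simp add: prob_measures_def finite_measures_def prob_space_def)

lemma coupling_measure_basics:
  assumes "\<mu> \<in> prob_measures" "coupling_measure \<mu> \<nu> Q"
  shows "prob_space Q" "sets Q = sets borel" "space Q = UNIV"
    "fst \<in> Q \<rightarrow>\<^sub>M borel" "snd \<in> Q \<rightarrow>\<^sub>M borel"
proof -
  show sets: "sets Q = sets borel" using assms by (simp add: coupling_measure_def)
  then show "space Q = UNIV" by (metis sets_eq_imp_space_eq space_borel)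
  have sets': "sets Q = sets (borel \<Otimes>\<^sub>M borel)" using sets unfolding borel_prod .
  show fst: "fst \<in> Q \<rightarrow>\<^sub>M borel" and "snd \<in> Q \<rightarrow>\<^sub>M borel"
    by (simp_all add: measurable_cong_sets[OF sets' refl])
  show "prob_space Q"
    using prob_space_distrD[OF fst] prob_measuresD(1)[OF assms(1)] assms(2)
    by (simp add: coupling_measure_def)
qed

text \<open>By Tonelli, integrating out one coordinate of the density leaves the constant 1 almost
  everywhere, so each marginal is the original factor.\<close>

lemma coupling_measure_density:
  assumes \<mu>: "prob_space \<mu>" "sets \<mu> = sets borel" and \<nu>: "prob_space \<nu>" "sets \<nu> = sets borel"
    and f[measurable]: "f \<in> borel_measurable (\<mu> \<Otimes>\<^sub>M \<nu>)"
    and 1: "AE x in \<mu>. (\<integral>\<^sup>+y. f (x, y) \<partial>\<nu>) = 1" and 2: "AE y in \<nu>. (\<integral>\<^sup>+x. f (x, y) \<partial>\<mu>) = 1"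
  shows "coupling_measure \<mu> \<nu> (density (\<mu> \<Otimes>\<^sub>M \<nu>) f)"
proof -
  interpret pair_prob_space \<mu> \<nu> using \<mu>(1) \<nu>(1) by (simp add: pair_prob_space_def pair_sigma_finite_def prob_space_imp_sigma_finite)
  let ?D = "density (\<mu> \<Otimes>\<^sub>M \<nu>) f"
  have sets_P: "sets (\<mu> \<Otimes>\<^sub>M \<nu>) = sets (borel \<Otimes>\<^sub>M borel)"
    by (rule sets_pair_measure_cong[OF \<mu>(2) \<nu>(2)])
  have fst[measurable]: "fst \<in> ?D \<rightarrow>\<^sub>M borel" and snd[measurable]: "snd \<in> ?D \<rightarrow>\<^sub>M borel"
    by (simp_all add: measurable_cong_sets[OF sets_P refl])
  have "distr ?D borel fst = \<mu>"
  proof (rule measure_eqI)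
    fix A assume "A \<in> sets (distr ?D borel fst)"
    then have A: "A \<in> sets borel" and [measurable]: "A \<in> sets \<mu>" using \<mu>(2) by auto
    have "emeasure (distr ?D borel fst) A = (\<integral>\<^sup>+z. f z * indicator A (fst z) \<partial>(\<mu> \<Otimes>\<^sub>M \<nu>))"
      using A by (subst emeasure_distr[OF fst A], subst emeasure_density)
        (auto intro!: nn_integral_cong measurable_sets[OF fst, simplified] simp: indicator_def)
    also have "\<dots> = (\<integral>\<^sup>+x. (\<integral>\<^sup>+y. f (x, y) * indicator A x \<partial>\<nu>) \<partial>\<mu>)"
      by (subst M2.nn_integral_fst[symmetric]) auto
    also have "\<dots> = (\<integral>\<^sup>+x. indicator A x \<partial>\<mu>)"
    proof (rule nn_integral_cong_AE)
      show "AE x in \<mu>. (\<integral>\<^sup>+y. f (x, y) * indicator A x \<partial>\<nu>) = indicator A x"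
        using 1 AE_space by eventually_elim (simp add: nn_integral_multc)
    qed
    finally show "emeasure (distr ?D borel fst) A = emeasure \<mu> A" by simp
  qed (simp add: \<mu>(2))
  moreover have "distr ?D borel snd = \<nu>"
  proof (rule measure_eqI)
    fix A assume "A \<in> sets (distr ?D borel snd)"
    then have A: "A \<in> sets borel" and [measurable]: "A \<in> sets \<nu>" using \<nu>(2) by auto
    have "emeasure (distr ?D borel snd) A = (\<integral>\<^sup>+z. f z * indicator A (snd z) \<partial>(\<mu> \<Otimes>\<^sub>M \<nu>))"
      using A by (subst emeasure_distr[OF snd A], subst emeasure_density)
        (auto intro!: nn_integral_cong measurable_sets[OF snd, simplified] simp: indicator_def)
    also have "\<dots> = (\<integral>\<^sup>+y. (\<integral>\<^sup>+x. f (x, y) * indicator A y \<partial>\<mu>) \<partial>\<nu>)"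
      by (subst nn_integral_snd[symmetric]) auto
    also have "\<dots> = (\<integral>\<^sup>+y. indicator A y \<partial>\<nu>)"
    proof (rule nn_integral_cong_AE)
      show "AE y in \<nu>. (\<integral>\<^sup>+x. f (x, y) * indicator A y \<partial>\<mu>) = indicator A y"
        using 2 AE_space by eventually_elim (simp add: nn_integral_multc)
    qed
    finally show "emeasure (distr ?D borel snd) A = emeasure \<nu> A" by simp
  qed (simp add: \<nu>(2))
  ultimately show ?thesis using sets_P unfolding borel_prod by (simp add: coupling_measure_def)
qed

lemma coupling_measure_product:
  assumes "prob_space \<mu>" "sets \<mu> = sets borel" "prob_space \<nu>" "sets \<nu> = sets borel"
  shows "coupling_measure \<mu> \<nu> (\<mu> \<Otimes>\<^sub>M \<nu>)"
  using coupling_measure_density[OF assms, of "\<lambda>_. 1"] assms(1,3)[THEN prob_space.emeasure_space_1]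
  by (simp add: density_1)

text \<open>A pair of random variables enters only through its joint law, and a joint law is
  realised by the two projections on the product space itself, a sample space of the type used in
  \<open>tau\<close>.\<close>

lemma order_prob_couplings:
  fixes \<mu> \<nu> :: "'a::polish_space measure"
  assumes r: "closed_partial_order r" and \<mu>: "\<mu> \<in> prob_measures" and \<nu>: "\<nu> \<in> prob_measures"
  shows "order_prob r `
      (couplings \<mu> \<nu> :: (('a \<times> 'a) measure \<times> ('a \<times> 'a \<Rightarrow> 'a) \<times> ('a \<times> 'a \<Rightarrow> 'a)) set)
    = {measure Q {(x, y). r x y} | Q. coupling_measure \<mu> \<nu> Q}" (is "?L = ?R")
proof
  have R: "{(x, y). r x y} \<in> sets borel"
    using r by (auto simp: closed_partial_order_def intro: borel_closed)
  show "?L \<subseteq> ?R"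
  proof
    fix p assume "p \<in> ?L"
    then obtain P :: "('a \<times> 'a) measure" and X Y where
      c: "(P, X, Y) \<in> couplings \<mu> \<nu>" and p: "p = order_prob r (P, X, Y)" by (auto simp del: split_paired_Ex)
    interpret prob_space P using c by (simp add: couplings_def)
    have X: "X \<in> P \<rightarrow>\<^sub>M borel" and Y: "Y \<in> P \<rightarrow>\<^sub>M borel"
      and law: "\<And>B. B \<in> sets borel \<Longrightarrow> measure P {w\<in>space P. X w \<in> B} = measure \<mu> B"
        "\<And>B. B \<in> sets borel \<Longrightarrow> measure P {w\<in>space P. Y w \<in> B} = measure \<nu> B"
      using c by (auto simp: couplings_def)
    have XY: "(\<lambda>w. (X w, Y w)) \<in> P \<rightarrow>\<^sub>M borel"
      using X Y unfolding borel_prod[symmetric] by measurable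
    have distr_eq: "distr P borel Z = \<kappa>"
      if "Z \<in> P \<rightarrow>\<^sub>M borel" "\<kappa> \<in> prob_measures"
        "\<And>B. B \<in> sets borel \<Longrightarrow> measure P {w\<in>space P. Z w \<in> B} = measure \<kappa> B"
      for Z and \<kappa> :: "'a measure"
    proof (rule measure_eqI)
      interpret \<kappa>: prob_space \<kappa> using prob_measuresD[OF that(2)] by simp
      show "sets (distr P borel Z) = sets \<kappa>" using prob_measuresD[OF that(2)] by simp
      fix B assume "B \<in> sets (distr P borel Z)"
      then show "emeasure (distr P borel Z) B = emeasure \<kappa> B"
        using that(1) that(3)[of B]
        by (simp add: emeasure_distr emeasure_eq_measure \<kappa>.emeasure_eq_measure vimage_def Int_def conj_commute)
    qed
    define Q where "Q = distr P borel (\<lambda>w. (X w, Y w))"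
    have "fst \<in> borel_measurable (borel :: ('a \<times> 'a) measure)" "snd \<in> borel_measurable (borel :: ('a \<times> 'a) measure)"
      unfolding borel_prod[symmetric] by measurable
    then have "coupling_measure \<mu> \<nu> Q"
      using XY distr_eq[OF X \<mu> law(1)] distr_eq[OF Y \<nu> law(2)]
      by (simp add: coupling_measure_def Q_def distr_distr o_def)
    moreover have "measure Q {(x, y). r x y} = p"
      unfolding Q_def by (subst measure_distr[OF XY R])
        (auto simp: p order_prob_def intro!: arg_cong[where f = "measure P"])
    ultimately show "p \<in> ?R" by blast
  qed
  show "?R \<subseteq> ?L"
  proof
    fix p assume "p \<in> ?R"
    then obtain Q where Q: "coupling_measure \<mu> \<nu> Q" and p: "p = measure Q {(x, y). r x y}" by blast
    note Q' = coupling_measure_basics[OF \<mu> Q]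
    have "measure Q {w. fst w \<in> B} = measure \<mu> B" "measure Q {w. snd w \<in> B} = measure \<nu> B"
      if "B \<in> sets borel" for B
      using measure_distr[OF Q'(4) that] measure_distr[OF Q'(5) that] Q Q'(3)
      by (simp_all add: coupling_measure_def vimage_def)
    then have "(Q, fst, snd) \<in> couplings \<mu> \<nu>"
      using Q' by (simp add: couplings_def)
    moreover have "order_prob r (Q, fst, snd) = p"
      using Q'(3) by (simp add: order_prob_def p case_prod_unfold)
    ultimately show "p \<in> ?L" by (metis image_eqI)
  qed
qed

text \<open>Along a maximising sequence of joint laws the mass of the complement of the order tends
  to \<open>1 - Sup A\<close>. This complement is open, so \<open>coupling_limit\<close> yields a
  joint law giving it no more mass, and this law attains the supremum.\<close>

lemma tau_attained:
  fixes \<mu> \<nu> :: "'a::polish_space measure"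
  assumes r: "closed_partial_order r" and \<mu>: "\<mu> \<in> prob_measures" and \<nu>: "\<nu> \<in> prob_measures"
  shows "\<exists>Q. coupling_measure \<mu> \<nu> Q \<and> measure Q {(x, y). r x y} = tau r \<mu> \<nu>"
    and "\<And>Q. coupling_measure \<mu> \<nu> Q \<Longrightarrow> measure Q {(x, y). r x y} \<le> tau r \<mu> \<nu>"
proof -
  let ?R = "{(x, y). r x y}"
  note \<mu>' = prob_measuresD[OF \<mu>] and \<nu>' = prob_measuresD[OF \<nu>]
  note basics = coupling_measure_basics[OF \<mu>]
  have R: "closed ?R" using r by (simp add: closed_partial_order_def)
  define A where "A = {measure Q ?R | Q. coupling_measure \<mu> \<nu> Q}"
  have "A \<noteq> {}" using coupling_measure_product[OF \<mu>'(1,2) \<nu>'(1,2)] by (auto simp: A_def)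
  have le1: "p \<le> 1" if "p \<in> A" for p using that prob_space.prob_le_1[OF basics(1)] by (auto simp: A_def)
  then have bdd: "bdd_above A" by (rule bdd_aboveI)
  have "\<exists>Q. coupling_measure \<mu> \<nu> Q \<and> Sup A - 1 / real (Suc n) < measure Q ?R" for n
  proof -
    have "Sup A - 1 / real (Suc n) < Sup A" by simp
    then obtain p where "p \<in> A" "Sup A - 1 / real (Suc n) < p"
      using less_cSup_iff[OF \<open>A \<noteq> {}\<close> bdd] by blast
    then show ?thesis unfolding A_def by blast
  qed
  then obtain Q where Q: "\<And>n. coupling_measure \<mu> \<nu> (Q n)"
    and Q_Sup: "\<And>n. Sup A - 1 / real (Suc n) < measure (Q n) ?R" by metis
  obtain U :: "nat \<Rightarrow> 'a set" and g where U: "\<And>k. open (U k)"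
    "\<And>V x. open V \<Longrightarrow> x \<in> V \<Longrightarrow> \<exists>k. x \<in> U k \<and> U k \<subseteq> V"
    "g \<in> bit_space \<rightarrow>\<^sub>M borel" "\<And>x. g (\<lambda>k. x \<in> U k) = x"
    using polish_base_decoder by blast
  have compl: "measure Q (- ?R) = 1 - measure Q ?R" if "coupling_measure \<mu> \<nu> Q" for Q
    using prob_space.prob_compl[OF basics(1)[OF that], of ?R] basics(2,3)[OF that] R
    by (simp add: Compl_eq_Diff_UNIV)
  have "\<exists>Q. coupling_measure \<mu> \<nu> Q \<and> measure Q (- ?R) \<le> 1 - Sup A"
  proof (rule coupling_limit[OF U \<mu>'(1,2) \<nu>'(1,2) Q])
    show "open (- ?R)" using R by (simp add: open_Compl)
    fix F e assume F: "(\<Union>(i, j)\<in>F. U i \<times> U j) \<subseteq> - ?R" and e: "0 < (e::real)"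
    have "\<forall>\<^sub>F n in sequentially. 1 / real (Suc n) < e"
      using order_tendstoD(2)[OF LIMSEQ_Suc[OF lim_1_over_n] e] .
    then show "\<forall>\<^sub>F n in sequentially. measure (Q n) (\<Union>(i, j)\<in>F. U i \<times> U j) \<le> 1 - Sup A + e"
    proof eventually_elim
      case (elim n)
      interpret prob_space "Q n" using basics(1)[OF Q] .
      have "measure (Q n) (\<Union>(i, j)\<in>F. U i \<times> U j) \<le> measure (Q n) (- ?R)"
        using F R basics(2)[OF Q] by (intro finite_measure_mono) (auto intro: borel_comp)
      also have "\<dots> \<le> 1 - Sup A + e" using compl[OF Q[of n]] Q_Sup[of n] elim by linarith
      finally show ?case .
    qed
  qed
  then obtain Q' where Q': "coupling_measure \<mu> \<nu> Q'" "Sup A \<le> measure Q' ?R" using compl by force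
  have ub: "p \<le> Sup A" if "p \<in> A" for p using that bdd by (rule cSup_upper)
  have "measure Q' ?R \<in> A" using Q'(1) unfolding A_def by blast
  with ub Q'(2) have "measure Q' ?R = Sup A" by (intro order_antisym) auto
  then have "Sup A \<in> A" using \<open>measure Q' ?R \<in> A\<close> by simp
  have "tau r \<mu> \<nu> = Sup A"
    unfolding tau_def order_prob_couplings[OF r \<mu> \<nu>] A_def[symmetric]
    by (rule Greatest_equality) (use ub \<open>Sup A \<in> A\<close> in auto)
  then show "\<exists>Q. coupling_measure \<mu> \<nu> Q \<and> measure Q ?R = tau r \<mu> \<nu>"
    using Q'(1) \<open>measure Q' ?R = Sup A\<close> by auto
  fix Q :: "('a \<times> 'a) measure" assume "coupling_measure \<mu> \<nu> Q"
  then have "measure Q ?R \<in> A" unfolding A_def by blast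
  then show "measure Q ?R \<le> tau r \<mu> \<nu>" using ub \<open>tau r \<mu> \<nu> = Sup A\<close> by simp
qed

subsection \<open>Strassen's theorem\<close>

text \<open>Witnesses in \<open>K\<close> for a convergent sequence have a convergent subsequence,
  and closedness of the relation passes to the limit pair.\<close>

lemma closed_upward_closure:
  fixes r :: "'a::metric_space \<Rightarrow> 'a \<Rightarrow> bool"
  assumes "closed {(x, y). r x y}" "compact K"
  shows "closed {y. \<exists>x\<in>K. r x y}"
  unfolding closed_sequential_limits
proof (intro allI impI)
  fix y l assume "(\<forall>n. y n \<in> {y. \<exists>x\<in>K. r x y}) \<and> y \<longlonglongrightarrow> l"
  then obtain x where x: "\<And>n. x n \<in> K" "\<And>n. r (x n) (y n)" and y: "y \<longlonglongrightarrow> l"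
    by simp metis
  obtain k s where k: "k \<in> K" "strict_mono s" "(x \<circ> s) \<longlonglongrightarrow> k"
    using compact_imp_seq_compact[OF assms(2)] x(1) by (metis seq_compactE)
  have lim: "(\<lambda>n. (x (s n), y (s n))) \<longlonglongrightarrow> (k, l)"
    using k(3) LIMSEQ_subseq_LIMSEQ[OF y k(2)] by (intro tendsto_Pair) (simp_all add: o_def)
  have "(k, l) \<in> {(x, y). r x y}"
    by (rule closed_sequentially[OF assms(1) _ lim]) (simp add: x(2))
  then show "l \<in> {y. \<exists>x\<in>K. r x y}" using k(1) by auto
qed

text \<open>Through these test functions \<open>sd_le\<close> becomes an inequality between the
  measures of Borel up-sets.\<close>

lemma indicator_increasing_fns:
  assumes "A \<in> sets borel" "\<And>x y. x \<in> A \<Longrightarrow> r x y \<Longrightarrow> y \<in> A"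
  shows "indicator A \<in> increasing_fns r"
proof -
  have "(SUP x. indicator A x :: real) \<le> 1" "(0::real) \<le> (INF x. indicator A x)"
    by (auto intro!: cSUP_least cINF_greatest simp: indicator_def)
  then have "(SUP x. indicator A x :: real) - (INF x. indicator A x) \<le> 1" by linarith
  moreover have "bounded (range (indicator A :: _ \<Rightarrow> real))"
    by (rule bounded_subset[of "{0, 1}"]) (auto simp: indicator_def)
  moreover have "monotone r (\<le>) (indicator A :: _ \<Rightarrow> real)"
    using assms(2) by (auto intro!: monotoneI simp: indicator_def)
  ultimately show ?thesis using assms(1) by (simp add: increasing_fns_def)
qed

text \<open>The up-closure of \<open>A\<close> need not be Borel, but that of a compact subset is closed;
  inner regularity closes the gap.\<close>

lemma sd_le_measure_mono:
  fixes \<mu> \<nu> :: "'a::polish_space measure"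
  assumes r: "closed_partial_order r" and \<mu>: "\<mu> \<in> prob_measures" and \<nu>: "\<nu> \<in> prob_measures"
    and sd: "sd_le r \<mu> \<nu>" and A: "A \<in> sets borel" and B: "B \<in> sets borel"
    and AB: "\<And>x y. x \<in> A \<Longrightarrow> r x y \<Longrightarrow> y \<in> B"
  shows "measure \<mu> A \<le> measure \<nu> B"
proof -
  note \<mu>' = prob_measuresD[OF \<mu>] and \<nu>' = prob_measuresD[OF \<nu>]
  interpret \<mu>: prob_space \<mu> by (rule \<mu>')
  interpret \<nu>: prob_space \<nu> by (rule \<nu>')
  have "emeasure \<mu> A = (SUP K\<in>{K. K \<subseteq> A \<and> compact K}. emeasure \<mu> K)"
    by (rule inner_regular) (use \<mu>' A in auto)
  also have "\<dots> \<le> emeasure \<nu> B"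
  proof (rule SUP_least, safe)
    fix K assume K: "K \<subseteq> A" "compact K"
    define C where "C = {y. \<exists>x\<in>K. r x y}"
    have "closed C"
      unfolding C_def by (rule closed_upward_closure) (use r K in \<open>auto simp: closed_partial_order_def\<close>)
    then have C: "C \<in> sets borel" by simp
    have "K \<subseteq> C" using r by (auto simp: C_def closed_partial_order_def dest: reflpD)
    then have "measure \<mu> K \<le> measure \<mu> C" using C \<mu>' by (intro \<mu>.finite_measure_mono) auto
    also have "\<dots> = (LINT x|\<mu>. indicator C x)" using C \<mu>' by simp
    also have "\<dots> \<le> (LINT x|\<nu>. indicator C x)"
    proof -
      have "indicator C \<in> increasing_fns r"
        using C r by (intro indicator_increasing_fns) (auto simp: C_def closed_partial_order_def dest: transpD)
      then show ?thesis using sd by (auto simp: sd_le_def)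
    qed
    also have "\<dots> = measure \<nu> C" using C \<nu>' by simp
    also have "\<dots> \<le> measure \<nu> B"
      using B K AB \<nu>' by (intro \<nu>.finite_measure_mono) (auto simp: C_def)
    finally show "emeasure \<mu> K \<le> emeasure \<nu> B"
      by (simp add: \<mu>.emeasure_eq_measure \<nu>.emeasure_eq_measure)
  qed
  finally show ?thesis by (simp add: \<mu>.emeasure_eq_measure \<nu>.emeasure_eq_measure)
qed

section \<open>Couplings from transport plans between finite partitions\<close>

text \<open>The integrand is constant on cells and contributes \<open>w t / m\<close> on cell
  \<open>t\<close>. A null cell has weight 0 by the bound on \<open>w\<close>, so the zero
  denominator there does no harm. This normalises one row or column of the density in
  \<open>coupling_of_cell_coupling\<close>.\<close>

lemma nn_integral_cells:
  assumes "prob_space \<nu>" and I: "finite I" and c: "c \<in> \<nu> \<rightarrow>\<^sub>M count_space I"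
    and w: "\<And>t. 0 \<le> w t" "\<And>t. t \<in> I \<Longrightarrow> w t \<le> measure \<nu> {y\<in>space \<nu>. c y = t}"
    and m: "(\<Sum>t\<in>I. w t) = m" "0 < m"
  shows "(\<integral>\<^sup>+y. ennreal (w (c y) / (m * measure \<nu> {z\<in>space \<nu>. c z = c y})) \<partial>\<nu>) = 1"
proof -
  interpret prob_space \<nu> by fact
  define b where "b t = measure \<nu> {y\<in>space \<nu>. c y = t}" for t
  have cell: "{y\<in>space \<nu>. c y = t} \<in> sets \<nu>" if "t \<in> I" for t
    using measurable_sets[OF c, of "{t}"] that by (simp add: vimage_def Int_def conj_commute)
  have cI: "c y \<in> I" if "y \<in> space \<nu>" for y using measurable_space[OF c that] by simp
  have "(\<integral>\<^sup>+y. ennreal (w (c y) / (m * b (c y))) \<partial>\<nu>)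
      = (\<integral>\<^sup>+y. (\<Sum>t\<in>I. ennreal (w t / (m * b t)) * indicator {y\<in>space \<nu>. c y = t} y) \<partial>\<nu>)"
  proof (rule nn_integral_cong)
    fix y assume y: "y \<in> space \<nu>"
    have "(\<Sum>t\<in>I. ennreal (w t / (m * b t)) * indicator {y\<in>space \<nu>. c y = t} y)
        = (\<Sum>t\<in>I. if t = c y then ennreal (w t / (m * b t)) else 0)"
      using y by (intro sum.cong) (auto simp: indicator_def)
    then show "ennreal (w (c y) / (m * b (c y)))
        = (\<Sum>t\<in>I. ennreal (w t / (m * b t)) * indicator {y\<in>space \<nu>. c y = t} y)"
      using I cI[OF y] by simp
  qed
  also have "\<dots> = (\<Sum>t\<in>I. ennreal (w t / (m * b t)) * emeasure \<nu> {y\<in>space \<nu>. c y = t})"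
    using cell by (simp add: nn_integral_sum nn_integral_cmult_indicator)
  also have "\<dots> = (\<Sum>t\<in>I. ennreal (w t / m))"
  proof (rule sum.cong)
    fix t assume "t \<in> I"
    then have "w t = 0" if "b t = 0" using w(1)[of t] w(2)[of t] that by (simp add: b_def)
    then show "ennreal (w t / (m * b t)) * emeasure \<nu> {y\<in>space \<nu>. c y = t} = ennreal (w t / m)"
      using w(1)[of t] m(2) unfolding emeasure_eq_measure b_def[symmetric]
      by (cases "b t = 0") (auto simp: ennreal_mult''[symmetric] b_def)
  qed simp
  also have "\<dots> = ennreal ((\<Sum>t\<in>I. w t) / m)"
    using w(1) m(2) by (simp add: sum_ennreal sum_divide_distrib)
  finally show ?thesis using m by (simp add: b_def)
qed

text \<open>The mass \<open>p s t\<close> is spread over the product of the cells \<open>s\<close>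
  and \<open>t\<close> in proportion to the product measure, which gives a density with respect to
  it. Where \<open>p\<close> vanishes the density vanishes.\<close>

lemma coupling_of_cell_coupling:
  fixes \<mu> \<nu> :: "'a::polish_space measure" and c :: "'a \<Rightarrow> 's"
  assumes \<mu>: "\<mu> \<in> prob_measures" and \<nu>: "\<nu> \<in> prob_measures"
    and I: "finite I" and c: "c \<in> borel \<rightarrow>\<^sub>M count_space I"
    and p: "\<And>s t. 0 \<le> p s t"
      "\<And>s. s \<in> I \<Longrightarrow> (\<Sum>t\<in>I. p s t) = measure \<mu> {x. c x = s}"
      "\<And>t. t \<in> I \<Longrightarrow> (\<Sum>s\<in>I. p s t) = measure \<nu> {y. c y = t}"
  shows "\<exists>Q. coupling_measure \<mu> \<nu> Q \<and>
    (\<forall>W\<in>sets borel. (\<forall>(x, y)\<in>W. p (c x) (c y) = 0) \<longrightarrow> measure Q W = 0)"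
proof -
  note \<mu>' = prob_measuresD[OF \<mu>] and \<nu>' = prob_measuresD[OF \<nu>]
  define a where "a s = measure \<mu> {x. c x = s}" for s
  define b where "b t = measure \<nu> {y. c y = t}" for t
  have cI: "c x \<in> I" for x using measurable_space[OF c, of x] by simp
  have c\<mu>[measurable]: "c \<in> \<mu> \<rightarrow>\<^sub>M count_space I" and c\<nu>[measurable]: "c \<in> \<nu> \<rightarrow>\<^sub>M count_space I"
    using c by (simp_all add: measurable_cong_sets[OF \<mu>'(2) refl] measurable_cong_sets[OF \<nu>'(2) refl])
  have p_le_a: "p s t \<le> a s" and p_le_b: "p s t \<le> b t" if "s \<in> I" "t \<in> I" for s t
    using member_le_sum[of t I "p s"] member_le_sum[of s I "\<lambda>s. p s t"] p that I
    by (auto simp: a_def b_def)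
  \<comment> \<open>Rows and columns through a null cell cannot be normalised; almost every point
    avoids these finitely many cells.\<close>
  have AE_pos: "AE x in \<kappa>. measure \<kappa> {z. c z = c x} \<noteq> 0"
    if "\<kappa> \<in> prob_measures" for \<kappa> :: "'a measure"
  proof -
    note \<kappa>' = prob_measuresD[OF that]
    interpret \<kappa>: prob_space \<kappa> by (rule \<kappa>')
    have cell: "{x. c x = s} \<in> sets \<kappa>" if "s \<in> I" for s
      using measurable_sets[OF c, of "{s}"] that \<kappa>' by (simp add: vimage_def)
    have "AE x in \<kappa>. \<forall>s\<in>I. measure \<kappa> {z. c z = s} = 0 \<longrightarrow> c x \<noteq> s"
    proof (rule AE_finite_allI[OF I])
      fix s assume "s \<in> I"
      then show "AE x in \<kappa>. measure \<kappa> {z. c z = s} = 0 \<longrightarrow> c x \<noteq> s"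
        using cell by (auto intro!: AE_I'[of "{x. c x = s}"] simp: null_sets_def \<kappa>.emeasure_eq_measure)
    qed
    then show ?thesis by eventually_elim (use cI in auto)
  qed
  define f where "f = (\<lambda>(x, y). ennreal (p (c x) (c y) / (a (c x) * b (c y))))"
  have f_meas: "f \<in> borel_measurable (\<mu> \<Otimes>\<^sub>M \<nu>)"
  proof -
    have "(\<lambda>z. (c (fst z), c (snd z))) \<in> \<mu> \<Otimes>\<^sub>M \<nu> \<rightarrow>\<^sub>M count_space I \<Otimes>\<^sub>M count_space I"
      by measurable
    then have 1: "(\<lambda>z. (c (fst z), c (snd z))) \<in> \<mu> \<Otimes>\<^sub>M \<nu> \<rightarrow>\<^sub>M count_space (I \<times> I)"
      by (simp add: pair_measure_count_space I)
    have 2: "(\<lambda>(s, t). ennreal (p s t / (a s * b t))) \<in> borel_measurable (count_space (I \<times> I))"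
      by simp
    show ?thesis
      using measurable_compose[OF 1 2] by (simp add: f_def case_prod_unfold)
  qed
  have Q: "coupling_measure \<mu> \<nu> (density (\<mu> \<Otimes>\<^sub>M \<nu>) f)"
  proof (rule coupling_measure_density[OF \<mu>'(1,2) \<nu>'(1,2) f_meas])
    show "AE x in \<mu>. (\<integral>\<^sup>+y. f (x, y) \<partial>\<nu>) = 1"
      using AE_pos[OF \<mu>]
    proof eventually_elim
      case (elim x)
      then show ?case
        using nn_integral_cells[OF \<nu>'(1) I c\<nu>, of "p (c x)" "a (c x)"] p(1,2) p_le_b cI \<nu>'(3)
        by (simp add: f_def a_def b_def zero_less_measure_iff)
    qed
    show "AE y in \<nu>. (\<integral>\<^sup>+x. f (x, y) \<partial>\<mu>) = 1"
      using AE_pos[OF \<nu>]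
    proof eventually_elim
      case (elim y)
      then show ?case
        using nn_integral_cells[OF \<mu>'(1) I c\<mu>, of "\<lambda>s. p s (c y)" "b (c y)"] p(1,3) p_le_a cI \<mu>'(3)
        by (simp add: f_def a_def b_def zero_less_measure_iff mult.commute)
    qed
  qed
  moreover have "measure (density (\<mu> \<Otimes>\<^sub>M \<nu>) f) W = 0"
    if W: "W \<in> sets borel" "\<forall>(x, y)\<in>W. p (c x) (c y) = 0" for W
  proof -
    have "sets (\<mu> \<Otimes>\<^sub>M \<nu>) = sets borel"
      using coupling_measure_basics(2)[OF \<mu> Q] by simp
    then have "emeasure (density (\<mu> \<Otimes>\<^sub>M \<nu>) f) W = (\<integral>\<^sup>+z. f z * indicator W z \<partial>(\<mu> \<Otimes>\<^sub>M \<nu>))"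
      using W f_meas by (intro emeasure_density) auto
    also have "\<dots> = (\<integral>\<^sup>+z. 0 \<partial>(\<mu> \<Otimes>\<^sub>M \<nu>))"
      using W(2) by (intro nn_integral_cong) (auto simp: f_def indicator_def split: prod.split)
    finally show ?thesis by (simp add: measure_def)
  qed
  ultimately show ?thesis by blast
qed

text \<open>A cell collects the points lying in the same ones of the first \<open>n\<close> base
  sets, and two cells are linked if they contain some ordered pair. Stochastic dominance gives
  Hall's condition for this relation, and a base rectangle disjoint from the order meets no linked
  pair of cells.\<close>

lemma strassen_approx:
  fixes \<mu> \<nu> :: "'a::polish_space measure" and U :: "nat \<Rightarrow> 'a set"
  assumes r: "closed_partial_order r" and \<mu>: "\<mu> \<in> prob_measures" and \<nu>: "\<nu> \<in> prob_measures"
    and sd: "sd_le r \<mu> \<nu>" and U: "\<And>k. open (U k)"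
  shows "\<exists>Q. coupling_measure \<mu> \<nu> Q \<and> (\<forall>F. F \<subseteq> {..<n} \<times> {..<n} \<longrightarrow>
    (\<Union>(i, j)\<in>F. U i \<times> U j) \<subseteq> - {(x, y). r x y} \<longrightarrow> measure Q (\<Union>(i, j)\<in>F. U i \<times> U j) = 0)"
proof -
  note \<mu>' = prob_measuresD[OF \<mu>] and \<nu>' = prob_measuresD[OF \<nu>]
  interpret \<mu>: prob_space \<mu> by (rule \<mu>')
  interpret \<nu>: prob_space \<nu> by (rule \<nu>')
  define I where "I = Pow {..<n}"
  define c where "c x = {k. k < n \<and> x \<in> U k}" for x
  have I: "finite I" by (simp add: I_def)
  have cI: "c x \<in> I" for x by (auto simp: c_def I_def)
  have cell: "{x. c x = s} \<in> sets borel" if "s \<in> I" for s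
  proof -
    note [measurable] = borel_open[OF U]
    have "{x\<in>space borel. \<forall>k\<in>{..<n}. x \<in> U k \<longleftrightarrow> k \<in> s} \<in> sets borel" by measurable
    moreover have "{x. c x = s} = {x\<in>space borel. \<forall>k\<in>{..<n}. x \<in> U k \<longleftrightarrow> k \<in> s}"
      using that by (auto simp: c_def I_def)
    ultimately show ?thesis by simp
  qed
  have cells: "{x. c x \<in> X} = (\<Union>s\<in>X. {x. c x = s})" for X by auto
  have cells_sets: "{x. c x \<in> X} \<in> sets borel" if "X \<subseteq> I" for X
    unfolding cells using that I cell by (intro sets.finite_UN) (auto intro: finite_subset)
  have c: "c \<in> borel \<rightarrow>\<^sub>M count_space I"
    using I cell cI by (auto simp: measurable_count_space_eq2 vimage_def)
  have sum_cells: "(\<Sum>s\<in>X. measure \<kappa> {x. c x = s}) = measure \<kappa> {x. c x \<in> X}"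
    if "X \<subseteq> I" "\<kappa> \<in> prob_measures" for X and \<kappa> :: "'a measure"
  proof -
    note \<kappa>' = prob_measuresD[OF that(2)]
    interpret \<kappa>: prob_space \<kappa> by (rule \<kappa>')
    show ?thesis
      unfolding cells using that I cell \<kappa>'
      by (intro \<kappa>.finite_measure_finite_Union[symmetric])
         (auto simp: disjoint_family_on_def intro: finite_subset)
  qed
  define E where "E s t \<longleftrightarrow> (\<exists>x y. c x = s \<and> c y = t \<and> r x y)" for s t
  let ?a = "\<lambda>s. measure \<mu> {x. c x = s}" and ?b = "\<lambda>t. measure \<nu> {y. c y = t}"
  have "\<exists>p. transport_plan E I I ?a ?b p"
  proof (rule fractional_hall[OF I I])
    fix X assume X: "X \<subseteq> I"
    \<comment> \<open>Every point above a point of the cells in \<open>X\<close> lies in a linked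
      cell, so dominance compares the two unions of cells.\<close>
    have "measure \<mu> {x. c x \<in> X} \<le> measure \<nu> {y. c y \<in> {t\<in>I. \<exists>s\<in>X. E s t}}"
    proof (rule sd_le_measure_mono[OF r \<mu> \<nu> sd cells_sets[OF X] cells_sets])
      fix x y assume "x \<in> {x. c x \<in> X}" "r x y"
      then show "y \<in> {y. c y \<in> {t\<in>I. \<exists>s\<in>X. E s t}}" using cI by (auto simp: E_def)
    qed auto
    then show "sum ?a X \<le> sum ?b {t\<in>I. \<exists>s\<in>X. E s t}"
      using sum_cells[OF X \<mu>] sum_cells[of "{t\<in>I. \<exists>s\<in>X. E s t}", OF _ \<nu>] by simp
  qed auto
  then obtain p where p: "transport_plan E I I ?a ?b p" ..
  have total: "sum ?a I = 1" "sum ?b I = 1"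
    using sum_cells[OF order_refl \<mu>] sum_cells[OF order_refl \<nu>] cI \<mu>.prob_space \<nu>.prob_space \<mu>'(3) \<nu>'(3)
    by simp_all
  \<comment> \<open>Both marginals have total mass 1, so the column deficits are nonnegative with
    sum zero and each of them vanishes.\<close>
  have col: "(\<Sum>s\<in>I. p s t) = ?b t" if "t \<in> I" for t
  proof -
    have "(\<Sum>t\<in>I. \<Sum>s\<in>I. p s t) = (\<Sum>s\<in>I. \<Sum>t\<in>I. p s t)" by (rule sum.swap)
    also have "\<dots> = sum ?a I" using transport_planD(3)[OF p] by simp
    finally have "(\<Sum>t\<in>I. ?b t - (\<Sum>s\<in>I. p s t)) = 0" using total by (simp add: sum_subtractf)
    then show ?thesis
      using transport_planD(4)[OF p] that I by (subst (asm) sum_nonneg_eq_0_iff) auto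
  qed
  obtain Q where Q: "coupling_measure \<mu> \<nu> Q"
    "\<And>W. W \<in> sets borel \<Longrightarrow> \<forall>(x, y)\<in>W. p (c x) (c y) = 0 \<Longrightarrow> measure Q W = 0"
    using coupling_of_cell_coupling[OF \<mu> \<nu> I c transport_planD(1)[OF p] transport_planD(3)[OF p] col]
    by blast
  have "measure Q (\<Union>(i, j)\<in>F. U i \<times> U j) = 0"
    if F: "F \<subseteq> {..<n} \<times> {..<n}" "(\<Union>(i, j)\<in>F. U i \<times> U j) \<subseteq> - {(x, y). r x y}" for F
  proof (rule Q(2))
    show "(\<Union>(i, j)\<in>F. U i \<times> U j) \<in> sets borel"
      using U by (intro borel_open) (auto intro!: open_UN open_Times)
    show "\<forall>(x, y)\<in>(\<Union>(i, j)\<in>F. U i \<times> U j). p (c x) (c y) = 0"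
    proof safe
      fix x y i j assume ij: "(i, j) \<in> F" "x \<in> U i" "y \<in> U j"
      show "p (c x) (c y) = 0"
      proof (rule ccontr)
        assume "p (c x) (c y) \<noteq> 0"
        then have "E (c x) (c y)" using transport_planD(2)[OF p] by blast
        then obtain x' y' where xy: "c x' = c x" "c y' = c y" "r x' y'"
          by (auto simp: E_def)
        \<comment> \<open>Membership in \<open>U i\<close> and \<open>U j\<close> depends only on
          the cell, so the ordered pair linking the two cells lies in the same rectangle, which was
          to avoid the order.\<close>
        have "i \<in> c x" "j \<in> c y" using ij F(1) by (auto simp: c_def)
        then have "x' \<in> U i" "y' \<in> U j" using xy by (auto simp: c_def)
        then show False using F(2) ij(1) xy(3) by blast
      qed
    qed
  qed
  then show ?thesis using Q(1) by blast
qed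

text \<open>A finite union of base rectangles missing the order is null for all but finitely many of
  the approximating couplings. \<open>coupling_limit\<close> with \<open>c = 0\<close> then gives a
  coupling under which the open complement of the order is null.\<close>

theorem strassen:
  fixes \<mu> \<nu> :: "'a::polish_space measure"
  assumes r: "closed_partial_order r" and \<mu>: "\<mu> \<in> prob_measures" and \<nu>: "\<nu> \<in> prob_measures"
    and sd: "sd_le r \<mu> \<nu>"
  shows "\<exists>Q. coupling_measure \<mu> \<nu> Q \<and> measure Q {(x, y). r x y} = 1"
proof -
  let ?R = "{(x, y). r x y}"
  note \<mu>' = prob_measuresD[OF \<mu>] and \<nu>' = prob_measuresD[OF \<nu>]
  have R: "closed ?R" using r by (simp add: closed_partial_order_def)
  obtain U :: "nat \<Rightarrow> 'a set" and g where U: "\<And>k. open (U k)"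
    "\<And>V x. open V \<Longrightarrow> x \<in> V \<Longrightarrow> \<exists>k. x \<in> U k \<and> U k \<subseteq> V"
    "g \<in> bit_space \<rightarrow>\<^sub>M borel" "\<And>x. g (\<lambda>k. x \<in> U k) = x"
    using polish_base_decoder by blast
  have "\<forall>n. \<exists>Q. coupling_measure \<mu> \<nu> Q \<and> (\<forall>F. F \<subseteq> {..<n} \<times> {..<n} \<longrightarrow>
    (\<Union>(i, j)\<in>F. U i \<times> U j) \<subseteq> - ?R \<longrightarrow> measure Q (\<Union>(i, j)\<in>F. U i \<times> U j) = 0)"
    by (intro allI strassen_approx[OF r \<mu> \<nu> sd U(1)])
  then obtain Q where *: "\<forall>n. coupling_measure \<mu> \<nu> (Q n) \<and> (\<forall>F. F \<subseteq> {..<n} \<times> {..<n} \<longrightarrow>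
    (\<Union>(i, j)\<in>F. U i \<times> U j) \<subseteq> - ?R \<longrightarrow> measure (Q n) (\<Union>(i, j)\<in>F. U i \<times> U j) = 0)"
    by (rule choice[THEN exE])
  then have Q: "coupling_measure \<mu> \<nu> (Q n)" for n by simp
  have Q0: "measure (Q n) (\<Union>(i, j)\<in>F. U i \<times> U j) = 0"
    if "F \<subseteq> {..<n} \<times> {..<n}" "(\<Union>(i, j)\<in>F. U i \<times> U j) \<subseteq> - ?R" for n F
    using *[rule_format, of n] that by simp
  have "\<exists>Q. coupling_measure \<mu> \<nu> Q \<and> measure Q (- ?R) \<le> 0"
  proof (rule coupling_limit[OF U \<mu>'(1,2) \<nu>'(1,2) Q])
    show "open (- ?R)" using R by (simp add: open_Compl)
    fix F e assume F: "finite F" "(\<Union>(i, j)\<in>F. U i \<times> U j) \<subseteq> - ?R" and e: "0 < (e::real)"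
    obtain m where m: "\<And>k. k \<in> fst ` F \<union> snd ` F \<Longrightarrow> k < m"
      using F(1) finite_nat_set_iff_bounded[of "fst ` F \<union> snd ` F"] by auto
    have "F \<subseteq> {..<n} \<times> {..<n}" if "m \<le> n" for n
      using m that by (force intro: less_le_trans)
    then show "\<forall>\<^sub>F n in sequentially. measure (Q n) (\<Union>(i, j)\<in>F. U i \<times> U j) \<le> 0 + e"
      using Q0[OF _ F(2)] e by (auto intro!: eventually_sequentiallyI[of m])
  qed
  then obtain Q where Q: "coupling_measure \<mu> \<nu> Q" "measure Q (- ?R) \<le> 0" by blast
  note basics = coupling_measure_basics[OF \<mu> Q(1)]
  have "measure Q (- ?R) = 1 - measure Q ?R"
    using prob_space.prob_compl[OF basics(1), of ?R] basics(2,3) R by (simp add: Compl_eq_Diff_UNIV)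
  then have "measure Q ?R = 1" using Q(2) prob_space.prob_le_1[OF basics(1), of ?R] by linarith
  then show ?thesis using Q(1) by blast
qed

subsection \<open>The axioms\<close>

text \<open>\<open>mixture\<close> is defined over Polish spaces and is applied below to joint laws
  on the product.\<close>

instance prod :: (polish_space, polish_space) polish_space ..

lemma closed_partial_order_sets:
  "closed_partial_order r \<Longrightarrow> {(x, y). r x y} \<in> sets borel"
  by (auto simp: closed_partial_order_def intro: borel_closed)

section \<open>Mixtures of measures and of their couplings\<close>

lemma mixture_prob:
  assumes \<mu>: "\<mu> \<in> prob_measures" and \<nu>: "\<nu> \<in> prob_measures" and l: "l \<in> {0..1}"
  shows "mixture l \<mu> \<nu> \<in> prob_measures"
proof (rule prob_measuresI)
  note \<mu>' = prob_measuresD[OF \<mu>] and \<nu>' = prob_measuresD[OF \<nu>]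
  show "sets (mixture l \<mu> \<nu>) = sets borel" by (rule sets_mixture)
  then have "space (mixture l \<mu> \<nu>) = UNIV" by (metis sets_eq_imp_space_eq space_borel)
  then show "prob_space (mixture l \<mu> \<nu>)"
    using \<mu>' \<nu>' l prob_space.emeasure_space_1[OF \<mu>'(1)] prob_space.emeasure_space_1[OF \<nu>'(1)]
    by (intro prob_spaceI) (simp add: emeasure_mixture ennreal_plus[symmetric] del: ennreal_plus)
qed

lemma distr_mixture:
  assumes Q: "sets Q1 = sets borel" "sets Q2 = sets borel" and f: "f \<in> borel \<rightarrow>\<^sub>M borel"
  shows "distr (mixture l Q1 Q2) borel f = mixture l (distr Q1 borel f) (distr Q2 borel f)"
proof (rule measure_eqI)
  have f': "f \<in> \<kappa> \<rightarrow>\<^sub>M borel" if "sets \<kappa> = sets borel" for \<kappa>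
    using f by (simp add: measurable_cong_sets[OF that refl])
  have space: "space \<kappa> = UNIV" if "sets \<kappa> = sets borel" for \<kappa> :: "'a measure"
    using sets_eq_imp_space_eq[OF that] by simp
  fix B assume "B \<in> sets (distr (mixture l Q1 Q2) borel f)"
  then have B: "B \<in> sets borel" by simp
  then have "f -` B \<in> sets borel" using measurable_sets[OF f B] by simp
  then show "emeasure (distr (mixture l Q1 Q2) borel f) B
      = emeasure (mixture l (distr Q1 borel f) (distr Q2 borel f)) B"
    using B Q by (simp add: emeasure_mixture emeasure_distr f' sets_mixture space)
qed (simp add: sets_mixture)

lemma coupling_measure_mixture:
  assumes "coupling_measure \<mu>1 \<nu>1 Q1" "coupling_measure \<mu>2 \<nu>2 Q2"
  shows "coupling_measure (mixture l \<mu>1 \<mu>2) (mixture l \<nu>1 \<nu>2) (mixture l Q1 Q2)"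
proof -
  have "fst \<in> borel_measurable (borel :: ('a \<times> 'a) measure)" "snd \<in> borel_measurable (borel :: ('a \<times> 'a) measure)"
    unfolding borel_prod[symmetric] by measurable
  then show ?thesis
    using assms by (simp add: coupling_measure_def distr_mixture sets_mixture)
qed

section \<open>The defining property and both axioms for \<open>tau\<close>\<close>

lemma sd_degree_tau:
  assumes r: "closed_partial_order r"
  shows "sd_degree r (tau r)"
  unfolding sd_degree_def
proof (intro ballI)
  fix \<mu> \<nu> :: "'a measure" assume \<mu>: "\<mu> \<in> prob_measures" and \<nu>: "\<nu> \<in> prob_measures"
  obtain Q where Q: "coupling_measure \<mu> \<nu> Q" "measure Q {(x, y). r x y} = tau r \<mu> \<nu>"
    using tau_attained(1)[OF r \<mu> \<nu>] by blast
  have "0 \<le> tau r \<mu> \<nu>" "tau r \<mu> \<nu> \<le> 1"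
    using Q(2) prob_space.prob_le_1[OF coupling_measure_basics(1)[OF \<mu> Q(1)], of "{(x, y). r x y}"]
    by (metis measure_nonneg, simp)
  moreover have "1 \<le> tau r \<mu> \<nu>" if "sd_le r \<mu> \<nu>"
    using strassen[OF r \<mu> \<nu> that] tau_attained(2)[OF r \<mu> \<nu>] by metis
  ultimately show "0 \<le> tau r \<mu> \<nu> \<and> tau r \<mu> \<nu> \<le> 1 \<and> (sd_le r \<mu> \<nu> \<longrightarrow> tau r \<mu> \<nu> = 1)"
    by force
qed

lemma axiom_M_tau:
  assumes r: "closed_partial_order r"
  shows "axiom_M r (tau r)"
  unfolding axiom_M_def
proof (intro ballI impI)
  fix \<mu>a \<mu>b \<nu>a \<nu>b :: "'a measure" and l :: real
  assume prob: "\<mu>a \<in> prob_measures" "\<mu>b \<in> prob_measures" "\<nu>a \<in> prob_measures" "\<nu>b \<in> prob_measures"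
    and l: "l \<in> {0..1}" and sd: "sd_le r \<mu>a \<nu>a"
  let ?R = "{(x, y). r x y}"
  obtain Qa where Qa: "coupling_measure \<mu>a \<nu>a Qa" "measure Qa ?R = 1"
    using strassen[OF r prob(1,3) sd] by blast
  \<comment> \<open>The second components are coupled independently; their contribution to the mass
    of the order is only bounded below by 0.\<close>
  have Qb: "coupling_measure \<mu>b \<nu>b (\<mu>b \<Otimes>\<^sub>M \<nu>b)"
    using prob(2,4)[THEN prob_measuresD(1)] prob(2,4)[THEN prob_measuresD(2)]
    by (intro coupling_measure_product)
  note a = coupling_measure_basics[OF prob(1) Qa(1)] and b = coupling_measure_basics[OF prob(2) Qb]
  define Q where "Q = mixture l Qa (\<mu>b \<Otimes>\<^sub>M \<nu>b)"
  have Q: "coupling_measure (mixture l \<mu>a \<mu>b) (mixture l \<nu>a \<nu>b) Q"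
    unfolding Q_def by (rule coupling_measure_mixture[OF Qa(1) Qb])
  interpret a: prob_space Qa by (rule a)
  interpret Q: prob_space Q by (rule coupling_measure_basics(1)[OF mixture_prob[OF prob(1,2) l] Q])
  have "ennreal l \<le> ennreal l * emeasure Qa ?R + ennreal (1 - l) * emeasure (\<mu>b \<Otimes>\<^sub>M \<nu>b) ?R"
    using Qa(2) by (simp add: a.emeasure_eq_measure)
  also have "\<dots> = emeasure Q ?R"
    unfolding Q_def using a b closed_partial_order_sets[OF r] by (simp add: emeasure_mixture)
  finally have "l \<le> measure Q ?R" by (simp add: Q.emeasure_eq_measure)
  also have "\<dots> \<le> tau r (mixture l \<mu>a \<mu>b) (mixture l \<nu>a \<nu>b)"
    using tau_attained(2)[OF r _ _ Q] prob l by (simp add: mixture_prob)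
  finally show "l \<le> tau r (mixture l \<mu>a \<mu>b) (mixture l \<nu>a \<nu>b)" .
qed

text \<open>The marginals of an optimal joint law restricted to the order lie below \<mu> and \<nu>
  and have mass exactly \<open>tau r \<mu> \<nu>\<close>. They are ordered because
  \<open>h x \<le> h y\<close> holds almost everywhere for the restricted law.\<close>

lemma axiom_C_tau:
  assumes r: "closed_partial_order r"
  shows "axiom_C r (tau r)"
  unfolding axiom_C_def
proof (intro ballI allI impI)
  fix \<mu> \<nu> :: "'a measure" and e :: real
  assume \<mu>: "\<mu> \<in> prob_measures" and \<nu>: "\<nu> \<in> prob_measures" and e: "0 < e"
  let ?R = "{(x, y). r x y}"
  note R = closed_partial_order_sets[OF r]
  obtain Q where Q: "coupling_measure \<mu> \<nu> Q" "measure Q ?R = tau r \<mu> \<nu>"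
    using tau_attained(1)[OF r \<mu> \<nu>] by blast
  note Q' = coupling_measure_basics[OF \<mu> Q(1)]
  interpret Q: prob_space Q by (rule Q')
  define P where "P = density Q (indicator ?R)"
  have emeasure_P: "emeasure P A = emeasure Q (?R \<inter> A)" if "A \<in> sets borel" for A
  proof -
    have "emeasure P A = (\<integral>\<^sup>+z. indicator ?R z * indicator A z \<partial>Q)"
      unfolding P_def using that R Q' by (intro emeasure_density) auto
    also have "\<dots> = (\<integral>\<^sup>+z. indicator (?R \<inter> A) z \<partial>Q)"
      by (simp only: indicator_inter_arith)
    also have "\<dots> = emeasure Q (?R \<inter> A)"
      using that R Q' by (intro nn_integral_indicator) auto
    finally show ?thesis .
  qed
  have space_P: "space P = UNIV" and sets_P: "sets P = sets borel" using Q' by (simp_all add: P_def)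
  interpret P: finite_measure P
    by (rule finite_measureI) (simp add: space_P emeasure_P)
  have marginal: "distr P borel \<pi> \<in> finite_measures" "setwise_le (distr P borel \<pi>) (distr Q borel \<pi>)"
    "measure (distr P borel \<pi>) UNIV = measure Q ?R"
    if \<pi>: "\<pi> \<in> Q \<rightarrow>\<^sub>M borel" for \<pi> :: "'a \<times> 'a \<Rightarrow> 'a"
  proof -
    have \<pi>': "\<pi> \<in> P \<rightarrow>\<^sub>M borel" using \<pi> by (simp add: P_def)
    show "distr P borel \<pi> \<in> finite_measures"
      using P.finite_measure_distr[OF \<pi>'] by (simp add: finite_measures_def)
    show "setwise_le (distr P borel \<pi>) (distr Q borel \<pi>)"
      unfolding setwise_le_def
    proof
      fix B :: "'a set" assume B: "B \<in> sets borel"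
      have "\<pi> -` B \<in> sets borel" using measurable_sets[OF \<pi> B] Q' by simp
      then show "emeasure (distr P borel \<pi>) B \<le> emeasure (distr Q borel \<pi>) B"
        using B R Q' by (simp add: emeasure_distr \<pi> \<pi>' space_P emeasure_P emeasure_mono)
    qed
    show "measure (distr P borel \<pi>) UNIV = measure Q ?R"
      using measure_distr[OF \<pi>', of UNIV] emeasure_P[of UNIV] by (simp add: space_P measure_def)
  qed
  have "sd_le r (distr P borel fst) (distr P borel snd)"
    unfolding sd_le_def
  proof (intro conjI ballI)
    show "measure (distr P borel fst) UNIV = measure (distr P borel snd) UNIV"
      using marginal(3)[OF Q'(4)] marginal(3)[OF Q'(5)] by simp
    fix h assume h: "h \<in> increasing_fns r"
    then have [measurable]: "h \<in> borel_measurable borel" and mono: "\<And>x y. r x y \<Longrightarrow> h x \<le> h y"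
      by (auto simp: increasing_fns_def dest: monotoneD)
    obtain b where b: "\<And>x. norm (h x) \<le> b"
      using h by (auto simp: increasing_fns_def bounded_iff)
    have [measurable]: "fst \<in> P \<rightarrow>\<^sub>M borel" "snd \<in> P \<rightarrow>\<^sub>M borel"
      using Q'(4,5) by (simp_all add: P_def)
    have "(\<integral>z. h (fst z) \<partial>P) \<le> (\<integral>z. h (snd z) \<partial>P)"
    proof (rule integral_mono_AE)
      show "integrable P (\<lambda>z. h (fst z))" "integrable P (\<lambda>z. h (snd z))"
        by (auto intro!: P.integrable_const_bound[where B = b] b)
      show "AE z in P. h (fst z) \<le> h (snd z)"
        unfolding P_def using R Q' mono by (subst AE_density) (auto simp: indicator_def)
    qed
    then show "(LINT x|distr P borel fst. h x) \<le> (LINT x|distr P borel snd. h x)"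
      by (simp add: integral_distr)
  qed
  then have "(distr P borel fst, distr P borel snd) \<in> ordered_component_pairs r \<mu> \<nu>"
    using marginal(1,2)[OF Q'(4)] marginal(1,2)[OF Q'(5)] Q(1)
    by (simp add: ordered_component_pairs_def coupling_measure_def)
  moreover have "tau r \<mu> \<nu> \<le> measure (distr P borel fst) UNIV + e"
    using marginal(3)[OF Q'(4)] Q(2) e by simp
  ultimately show "\<exists>(\<mu>', \<nu>')\<in>ordered_component_pairs r \<mu> \<nu>. tau r \<mu> \<nu> \<le> measure \<mu>' UNIV + e"
    by (intro bexI[of _ "(distr P borel fst, distr P borel snd)"]) simp_all
qed

section \<open>Lower bounds from ordered components and uniqueness\<close>

text \<open>The normalised component with weight \<open>m\<close> and the normalised remainder \<mu>
  - \<mu>' with weight \<open>1 - m\<close> add up to \<mu>.\<close>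

lemma mixture_with_component:
  fixes \<mu> \<mu>' :: "'a::polish_space measure"
  assumes \<mu>: "\<mu> \<in> prob_measures" and fin: "\<mu>' \<in> finite_measures" and le: "setwise_le \<mu>' \<mu>"
    and m: "measure \<mu>' UNIV = m" "0 < m"
  shows "m \<le> 1" "density \<mu>' (\<lambda>_. ennreal (1 / m)) \<in> prob_measures"
    "\<exists>\<rho>\<in>prob_measures. mixture m (density \<mu>' (\<lambda>_. ennreal (1 / m))) \<rho> = \<mu>"
proof -
  note \<mu>' = prob_measuresD[OF \<mu>]
  interpret \<mu>: prob_space \<mu> by (rule \<mu>')
  interpret \<mu>': finite_measure \<mu>' using fin by (simp add: finite_measures_def)
  have sets': "sets \<mu>' = sets borel" using fin by (simp add: finite_measures_def)
  then have space': "space \<mu>' = UNIV" by (metis sets_eq_imp_space_eq space_borel)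
  have le': "measure \<mu>' B \<le> measure \<mu> B" if "B \<in> sets borel" for B
    using le that by (simp add: setwise_le_def \<mu>.emeasure_eq_measure \<mu>'.emeasure_eq_measure)
  show m1: "m \<le> 1" using le'[of UNIV] m(1) \<mu>.prob_space \<mu>'(3) by simp
  have scaled: "emeasure (density \<mu>' (\<lambda>_. ennreal (1 / m))) B = ennreal (measure \<mu>' B / m)"
    if "B \<in> sets borel" for B
    using that sets' m(2)
    by (simp add: emeasure_density_const \<mu>'.emeasure_eq_measure ennreal_mult[symmetric])
  show "density \<mu>' (\<lambda>_. ennreal (1 / m)) \<in> prob_measures"
    using scaled[of UNIV] m space' sets' by (intro prob_measuresI prob_spaceI) simp_all
  define \<kappa> where "\<kappa> = diff_measure \<mu> \<mu>'"
  have \<kappa>: "emeasure \<kappa> B = ennreal (measure \<mu> B - measure \<mu>' B)" if "B \<in> sets borel" for B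
    unfolding \<kappa>_def using that \<mu>' sets' le \<mu>.finite_measure_axioms \<mu>'.finite_measure_axioms
    by (subst emeasure_diff_measure)
       (auto simp: setwise_le_def \<mu>.emeasure_eq_measure \<mu>'.emeasure_eq_measure ennreal_minus)
  have sets_\<kappa>: "sets \<kappa> = sets borel" and space_\<kappa>: "space \<kappa> = UNIV"
    using \<mu>' by (simp_all add: \<kappa>_def)
  have total: "emeasure \<kappa> UNIV = ennreal (1 - m)"
    using \<kappa>[of UNIV] m(1) \<mu>.prob_space \<mu>'(3) by simp
  \<comment> \<open>For \<open>m = 1\<close> the remainder is null and cannot be normalised; it
    enters with weight 0, and \<mu> stands in as a probability measure.\<close>
  define \<rho> where "\<rho> = (if m = 1 then \<mu> else density \<kappa> (\<lambda>_. ennreal (1 / (1 - m))))"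
  have \<rho>: "\<rho> \<in> prob_measures"
    using \<mu> m1 total sets_\<kappa> space_\<kappa>
    by (auto simp: \<rho>_def emeasure_density_const ennreal_mult[symmetric] intro!: prob_measuresI prob_spaceI)
  have rest: "ennreal (1 - m) * emeasure \<rho> B = emeasure \<kappa> B" if B: "B \<in> sets borel" for B
  proof (cases "m = 1")
    case True
    have "emeasure \<kappa> B \<le> emeasure \<kappa> UNIV" using B sets_\<kappa> by (intro emeasure_mono) auto
    then show ?thesis using True total by simp
  next
    case False
    then show ?thesis
      using m1 B sets_\<kappa> \<kappa>[OF B] le'[OF B]
      by (simp add: \<rho>_def emeasure_density_const ennreal_mult[symmetric])
  qed
  have "mixture m (density \<mu>' (\<lambda>_. ennreal (1 / m))) \<rho> = \<mu>"
  proof (rule measure_eqI)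
    fix B assume "B \<in> sets (mixture m (density \<mu>' (\<lambda>_. ennreal (1 / m))) \<rho>)"
    then have B: "B \<in> sets borel" by (simp add: sets_mixture)
    show "emeasure (mixture m (density \<mu>' (\<lambda>_. ennreal (1 / m))) \<rho>) B = emeasure \<mu> B"
      using B sets' prob_measuresD(2)[OF \<rho>] m(2) le'[OF B]
      by (simp add: emeasure_mixture rest \<kappa> scaled ennreal_mult[symmetric] ennreal_plus[symmetric]
          \<mu>.emeasure_eq_measure del: ennreal_plus)
  qed (simp add: sets_mixture \<mu>')
  then show "\<exists>\<rho>\<in>prob_measures. mixture m (density \<mu>' (\<lambda>_. ennreal (1 / m))) \<rho> = \<mu>"
    using \<rho> by blast
qed

text \<open>Dividing both components by their common mass \<open>m\<close> preserves the order
  between them, and Axiom M with weight \<open>m\<close> applies to the resulting mixtures, which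
  are \<mu> and \<nu>.\<close>

lemma component_mass_le:
  assumes deg: "sd_degree r \<delta>" and M: "axiom_M r \<delta>"
    and \<mu>: "\<mu> \<in> prob_measures" and \<nu>: "\<nu> \<in> prob_measures"
    and pair: "(\<mu>', \<nu>') \<in> ordered_component_pairs r \<mu> \<nu>"
  shows "measure \<mu>' UNIV \<le> \<delta> \<mu> \<nu>"
\<comment> \<open>A null component cannot be normalised, but then the bound is just nonnegativity of
  \<delta>.\<close>
proof (cases "measure \<mu>' UNIV = 0")
  case True
  then show ?thesis using deg \<mu> \<nu> by (simp add: sd_degree_def)
next
  case False
  define m where "m = measure \<mu>' UNIV"
  have m: "0 < m" using False by (simp add: m_def zero_less_measure_iff)
  have fin: "\<mu>' \<in> finite_measures" "\<nu>' \<in> finite_measures" and le: "setwise_le \<mu>' \<mu>" "setwise_le \<nu>' \<nu>"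
    and sd: "sd_le r \<mu>' \<nu>'"
    using pair by (auto simp: ordered_component_pairs_def)
  have m': "measure \<nu>' UNIV = m" using sd by (simp add: sd_le_def m_def)
  let ?n = "\<lambda>\<kappa>. density \<kappa> (\<lambda>_. ennreal (1 / m))"
  note 1 = mixture_with_component[OF \<mu> fin(1) le(1) m_def[symmetric] m]
  note 2 = mixture_with_component[OF \<nu> fin(2) le(2) m' m]
  obtain \<rho> where \<rho>: "\<rho> \<in> prob_measures" "mixture m (?n \<mu>') \<rho> = \<mu>" using 1(3) by blast
  obtain \<sigma> where \<sigma>: "\<sigma> \<in> prob_measures" "mixture m (?n \<nu>') \<sigma> = \<nu>" using 2(3) by blast
  have "sd_le r (?n \<mu>') (?n \<nu>')"
    unfolding sd_le_def
  proof (intro conjI ballI)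
    have "measure (?n \<mu>') UNIV = 1" "measure (?n \<nu>') UNIV = 1"
      using 1(2) 2(2) by (simp_all add: prob_measures_def)
    then show "measure (?n \<mu>') UNIV = measure (?n \<nu>') UNIV" by simp
    fix h assume h: "h \<in> increasing_fns r"
    have "h \<in> borel_measurable \<kappa>" if \<kappa>: "\<kappa> \<in> finite_measures" for \<kappa>
    proof -
      have sets: "sets \<kappa> = sets borel" using \<kappa> by (simp add: finite_measures_def)
      show ?thesis
        using h by (simp add: increasing_fns_def measurable_cong_sets[OF sets refl])
    qed
    then have "(LINT x|?n \<kappa>. h x) = (LINT x|\<kappa>. h x) / m" if "\<kappa> \<in> finite_measures" for \<kappa>
      using that m by (subst integral_density) auto
    then show "(LINT x|?n \<mu>'. h x) \<le> (LINT x|?n \<nu>'. h x)"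
      using sd h fin m by (simp add: sd_le_def divide_right_mono)
  qed
  then have "m \<le> \<delta> (mixture m (?n \<mu>') \<rho>) (mixture m (?n \<nu>') \<sigma>)"
    using M 1(1,2) 2(2) \<rho>(1) \<sigma>(1) m unfolding axiom_M_def by auto
  then show ?thesis unfolding \<rho>(2) \<sigma>(2) by (simp add: m_def)
qed

text \<open>The component pair that Axiom C supplies for \<open>\<delta>1\<close> has mass at most
  \<open>\<delta>2 \<mu> \<nu>\<close>. Exchanging the roles of two functions that satisfy both
  axioms makes them equal.\<close>

lemma axiom_C_le_axiom_M:
  assumes "axiom_C r \<delta>1" "sd_degree r \<delta>2" "axiom_M r \<delta>2" "\<mu> \<in> prob_measures" "\<nu> \<in> prob_measures"
  shows "\<delta>1 \<mu> \<nu> \<le> \<delta>2 \<mu> \<nu>"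
proof (rule field_le_epsilon)
  fix e :: real assume "0 < e"
  then obtain \<mu>' \<nu>' where "(\<mu>', \<nu>') \<in> ordered_component_pairs r \<mu> \<nu>" "\<delta>1 \<mu> \<nu> \<le> measure \<mu>' UNIV + e"
    using assms(1,4,5) unfolding axiom_C_def by fast
  then show "\<delta>1 \<mu> \<nu> \<le> \<delta>2 \<mu> \<nu> + e"
    using component_mass_le[OF assms(2-5), of \<mu>' \<nu>'] by linarith
qed

theorem theorem4p1:
  fixes r :: "'a::polish_space \<Rightarrow> 'a \<Rightarrow> bool"
  assumes "closed_partial_order r"
  shows "sd_degree r (tau r) \<and> axiom_C r (tau r) \<and> axiom_M r (tau r) \<and>
    (\<forall>\<delta>. sd_degree r \<delta> \<and> axiom_C r \<delta> \<and> axiom_M r \<delta> \<longrightarrow>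
      (\<forall>\<mu>\<in>prob_measures. \<forall>\<nu>\<in>prob_measures. \<delta> \<mu> \<nu> = tau r \<mu> \<nu>))"
proof (intro conjI allI impI ballI)
  show deg: "sd_degree r (tau r)" by (rule sd_degree_tau[OF assms])
  show C: "axiom_C r (tau r)" by (rule axiom_C_tau[OF assms])
  show M: "axiom_M r (tau r)" by (rule axiom_M_tau[OF assms])
  fix \<delta> and \<mu> \<nu> :: "'a measure"
  assume \<delta>: "sd_degree r \<delta> \<and> axiom_C r \<delta> \<and> axiom_M r \<delta>"
    and prob: "\<mu> \<in> prob_measures" "\<nu> \<in> prob_measures"
  show "\<delta> \<mu> \<nu> = tau r \<mu> \<nu>"
  proof (rule order_antisym)
    show "\<delta> \<mu> \<nu> \<le> tau r \<mu> \<nu>"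
      by (rule axiom_C_le_axiom_M[OF _ deg M prob]) (use \<delta> in simp)
    show "tau r \<mu> \<nu> \<le> \<delta> \<mu> \<nu>"
      by (rule axiom_C_le_axiom_M[OF C _ _ prob]) (use \<delta> in simp_all)
  qed
qed

end
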